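(* Let $k\ge 3$ and $m>5$. Among all bicyclic $k$-uniform power hypergraphs with $m$ edges, the unique hypergraph with maximum spectral radius is $B_m^P:=H_m^k$, where $H_m$ is the simple graph obtained from $K_4-e$ (the complete graph on 4 vertices with one edge deleted) by attaching a star $K_{1,m-5}$ with its center at a vertex of degree $3$ of $K_4-e$.
   Context: A $k$-uniform hypergraph $G=(V,E)$ has finite vertex set $V$ and edge set $E\subseteq\binom{V}{k}$. A walk is an alternating sequence $v_0e_1v_1\cdots e_lv_l$ with $\{v_{i-1},v_i\}\subseteq e_i$; $G$ is connected if every two vertices are joined by a walk. The cyclomatic number of a $k$-uniform hypergraph with $n$ vertices, $m$ edges and $l$ connected components is $m(k-1)-n+l$; a connected hypergraph is bicyclic if its cyclomatic number is $2$. For a simple graph $H=(V,E)$, its $k$-th power $H^k$ is the $k$-uniform hypergraph obtained by adding, for each edge $e\in E$, $k-2$ new vertices $i_{e,1},\dots,i_{e,k-2}$ and replacing $e$ by $e\cup\{i_{e,1},\dots,i_{e,k-2}\}$; a power hypergraph is one of the form $H^k$. If $V=\{v_1,\dots,v_n\}$, the adjacency tensor $\mathcal{A}(G)$ has entries $a_{i_1\cdots i_k}=\frac{1}{(k-1)!}$ if $\{v_{i_1},\dots,v_{i_k}\}\in E$ and $0$ otherwise; $\lambda\in\mathbb{C}$ is an eigenvalue if there is a nonzero $x\in\mathbb{C}^n$ with $\sum_{i_2,\dots,i_k}a_{ii_2\cdots i_k}x_{i_2}\cdots x_{i_k}=\lambda x_i^{k-1}$ for all $i$; the spectral radius is the maximum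 modulus of the eigenvalues. *)

theory Defs
  imports Complex_Main
begin

record 'a hypergraph =
  verts :: "'a set"
  edges :: "'a set set"

definition uniform_hypergraph :: "nat \<Rightarrow> 'a hypergraph \<Rightarrow> bool" where
  "uniform_hypergraph k G \<longleftrightarrow>
     finite (verts G) \<and> edges G \<subseteq> {e. e \<subseteq> verts G \<and> card e = k}"

abbreviation simple_graph :: "'a hypergraph \<Rightarrow> bool" where
  "simple_graph H \<equiv> uniform_hypergraph 2 H"

definition hypergraph_iso :: "'a hypergraph \<Rightarrow> 'b hypergraph \<Rightarrow> bool" where
  "hypergraph_iso G G' \<longleftrightarrow>
     (\<exists>f. bij_betw f (verts G) (verts G') \<and> (\<lambda>e. f ` e) ` edges G = edges G')"


(* The walk v_0 e_1 v_1 ... e_l v_l is stored as its list of vertices [v_0, ..., v_l]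
   and its list of edges [e_1, ..., e_l]. *)
definition walk :: "'a hypergraph \<Rightarrow> 'a list \<Rightarrow> 'a set list \<Rightarrow> bool" where
  "walk G vs es \<longleftrightarrow>
     length vs = Suc (length es) \<and> set vs \<subseteq> verts G \<and> set es \<subseteq> edges G \<and>
     (\<forall>i < length es. {vs ! i, vs ! Suc i} \<subseteq> es ! i)"

definition joined :: "'a hypergraph \<Rightarrow> 'a \<Rightarrow> 'a \<Rightarrow> bool" where
  "joined G u v \<longleftrightarrow> (\<exists>vs es. walk G vs es \<and> hd vs = u \<and> last vs = v)"

definition connected_hypergraph :: "'a hypergraph \<Rightarrow> bool" where
  "connected_hypergraph G \<longleftrightarrow> (\<forall>u \<in> verts G. \<forall>v \<in> verts G. joined G u v)"

definition components :: "'a hypergraph \<Rightarrow> 'a set set" where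
  "components G = verts G // {(u, v). u \<in> verts G \<and> v \<in> verts G \<and> joined G u v}"

definition cyclomatic_number :: "nat \<Rightarrow> 'a hypergraph \<Rightarrow> int" where
  "cyclomatic_number k G =
     int (card (edges G)) * (int k - 1) - int (card (verts G)) + int (card (components G))"

definition bicyclic :: "nat \<Rightarrow> 'a hypergraph \<Rightarrow> bool" where
  "bicyclic k G \<longleftrightarrow> connected_hypergraph G \<and> cyclomatic_number k G = 2"


(* Inl v is the original vertex v; Inr (e, j) is the new vertex i_{e,j}. *)
definition power_of_graph :: "'a hypergraph \<Rightarrow> nat \<Rightarrow> ('a + 'a set \<times> nat) hypergraph" where
  "power_of_graph H k =
     \<lparr> verts = Inl ` verts H \<union> Inr ` (edges H \<times> {1..k - 2}),
       edges = (\<lambda>e. Inl ` e \<union> Inr ` ({e} \<times> {1..k - 2})) ` edges H \<rparr>"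

(* Taking H over the vertex type of G loses nothing: if G is isomorphic to H^k, then H has a
   copy whose vertices are the vertices of G that correspond to those of H. *)
definition power_hypergraph :: "nat \<Rightarrow> 'a hypergraph \<Rightarrow> bool" where
  "power_hypergraph k G \<longleftrightarrow>
     (\<exists>H :: 'a hypergraph. simple_graph H \<and> hypergraph_iso G (power_of_graph H k))"


(* Tensor indices are the vertices themselves; an index tuple is a list of length k. *)
definition adjacency_tensor :: "nat \<Rightarrow> 'a hypergraph \<Rightarrow> 'a list \<Rightarrow> complex" where
  "adjacency_tensor k G is = (if set is \<in> edges G then 1 / fact (k - 1) else 0)"

(* Only the values of x on the vertices of G matter. *)
definition eigenvalue :: "nat \<Rightarrow> 'a hypergraph \<Rightarrow> complex \<Rightarrow> bool" where
  "eigenvalue k G lam \<longleftrightarrow>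
     (\<exists>x :: 'a \<Rightarrow> complex. (\<exists>i \<in> verts G. x i \<noteq> 0) \<and>
        (\<forall>i \<in> verts G.
           (\<Sum>is \<in> {is. set is \<subseteq> verts G \<and> length is = k - 1}.
              adjacency_tensor k G (i # is) * prod_list (map x is)) = lam * x i ^ (k - 1)))"

(* The maximum modulus: for a nonempty k-uniform hypergraph the set of eigenvalues is nonempty
   and compact, so the supremum is attained. *)
definition spectral_radius :: "nat \<Rightarrow> 'a hypergraph \<Rightarrow> real" where
  "spectral_radius k G = Sup {cmod lam | lam. eigenvalue k G lam}"


(* K_4 on {0,1,2,3} without the edge {2,3}; its vertices of degree 3 are 0 and 1. *)
definition K4_minus_edge :: "nat hypergraph" where
  "K4_minus_edge =
     \<lparr> verts = {0, 1, 2, 3},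
       edges = {e. e \<subseteq> {0, 1, 2, 3} \<and> card e = 2} - {{2, 3}} \<rparr>"

(* The star K_{1,m-5} has center 0 and the m - 5 leaves 4, ..., m - 2. *)
definition H_graph :: "nat \<Rightarrow> nat hypergraph" where
  "H_graph m =
     \<lparr> verts = verts K4_minus_edge \<union> {4..<m - 1},
       edges = edges K4_minus_edge \<union> (\<lambda>j. {0, j}) ` {4..<m - 1} \<rparr>"

definition B_P :: "nat \<Rightarrow> nat \<Rightarrow> (nat + nat set \<times> nat) hypergraph" where
  "B_P k m = power_of_graph (H_graph m) k"

definition bicyclic_power_hypergraph :: "nat \<Rightarrow> nat \<Rightarrow> 'a hypergraph \<Rightarrow> bool" where
  "bicyclic_power_hypergraph k m G \<longleftrightarrow>
     uniform_hypergraph k G \<and> power_hypergraph k G \<and> bicyclic k G \<and> card (edges G) = m"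

end

theory Submission
  imports Defs "HOL-Analysis.Analysis" "HOL-Combinatorics.Multiset_Permutations"
begin

text \<open>Eigenvalues of \<open>H\<^sup>k\<close> correspond to those of \<open>H\<close>: eliminating the new vertices turns
  the eigenvalue equation of the tensor into an inequality for the quadratic form
  \<open>2 * (\<Sum>uv\<in>E. y u * y v)\<close> of \<open>H\<close>, and the spectral radius of \<open>H\<^sup>k\<close> is
  \<open>\<rho>(H) powr (2 / k)\<close>. It remains to maximise this form over connected graphs with
  \<open>m - 1\<close> vertices and \<open>m\<close> edges. For a nonnegative vector \<open>y\<close>, whose entries sorted in
  decreasing order are \<open>y\<^sub>1, y\<^sub>2, \<dots>\<close>, the edges of a breadth-first tree rooted at the first vertex
  contribute at most \<open>\<Sum>j\<ge>2. y\<^sub>1 * y\<^sub>j\<close> and the two remaining edges at most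
  \<open>y\<^sub>2 * y\<^sub>3 + y\<^sub>2 * y\<^sub>4\<close>; the sum of these bounds is the form of \<open>H\<^sub>m\<close> at the sorted vector.
  Equality forces \<open>y\<close> to be the Perron vector of \<open>H\<^sub>m\<close>, whence \<open>H\<close> is isomorphic to \<open>H\<^sub>m\<close>.
  Otherwise compactness of the sphere makes the gap between the two maxima strict.\<close>

section \<open>Eigenvalues and isomorphisms\<close>

text \<open>The nonzero entries in row \<open>i\<close> come from the enumerations of
  \<open>e - {i}\<close> for the edges \<open>e\<close> at \<open>i\<close>. Each such set has
  \<open>(k - 1)!\<close> enumerations, which cancels the denominator of the tensor. All later work
  uses this sum over edges.\<close>

lemma adjacency_tensor_apply:
  assumes G: "uniform_hypergraph k G" and k: "k \<ge> 1"
  shows "(\<Sum>is \<in> {is. set is \<subseteq> verts G \<and> length is = k - 1}.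
            adjacency_tensor k G (i # is) * prod_list (map x is)) =
         (\<Sum>e \<in> {e \<in> edges G. i \<in> e}. prod x (e - {i}))"
proof -
  let ?S = "{is. set is \<subseteq> verts G \<and> length is = k - 1}"
  let ?E = "{e \<in> edges G. i \<in> e}"
  have finV: "finite (verts G)" and E: "\<And>e. e \<in> edges G \<Longrightarrow> e \<subseteq> verts G \<and> card e = k"
    using G by (auto simp: uniform_hypergraph_def)
  have finE: "finite ?E"
    by (rule finite_subset[of _ "Pow (verts G)"]) (use E finV in auto)
  have fe: "finite e" if "e \<in> ?E" for e using that E finV finite_subset by blast
  have finS: "finite ?S" using finite_lists_length_eq[OF finV] .
  have eq: "{is \<in> ?S. set (i # is) \<in> edges G} = (\<Union>e\<in>?E. permutations_of_set (e - {i}))"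
  proof (intro equalityI subsetI)
    fix xs assume xs: "xs \<in> {is \<in> ?S. set (i # is) \<in> edges G}"
    then have c: "card (insert i (set xs)) = k" and len: "length xs = k - 1"
      and mem: "insert i (set xs) \<in> ?E"
      using E by auto
    \<comment> \<open>Otherwise the index tuple would have at most \<open>k - 1\<close> distinct
      entries, too few for an edge. The same count then excludes repetitions inside
      \<open>xs\<close>.\<close>
    have "i \<notin> set xs"
    proof
      assume "i \<in> set xs"
      then have "card (set xs) = k" using c by (simp add: insert_absorb)
      then show False using card_length[of xs] len k by linarith
    qed
    then have "card (set xs) = k - 1" using c by simp
    then have "distinct xs" using len by (simp add: card_distinct)
    then have "xs \<in> permutations_of_set (insert i (set xs) - {i})"
      using \<open>i \<notin> set xs\<close> by (simp add: permutations_of_set_def)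
    then show "xs \<in> (\<Union>e\<in>?E. permutations_of_set (e - {i}))"
      using mem by blast
  next
    fix xs assume "xs \<in> (\<Union>e\<in>?E. permutations_of_set (e - {i}))"
    then obtain e where e: "e \<in> edges G" "i \<in> e" and s: "set xs = e - {i}" and d: "distinct xs"
      by (auto simp: permutations_of_set_def)
    have "length xs = k - 1"
      using distinct_card[OF d] s E[OF e(1)] e finV finite_subset by fastforce
    moreover have "insert i (set xs) = e" using s e by auto
    ultimately show "xs \<in> {is \<in> ?S. set (i # is) \<in> edges G}"
      using s e E[OF e(1)] by auto
  qed
  have "(\<Sum>is \<in> ?S. adjacency_tensor k G (i # is) * prod_list (map x is)) =
        (\<Sum>is \<in> {is \<in> ?S. set (i # is) \<in> edges G}. prod_list (map x is) / fact (k - 1))"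
    by (rule sum.mono_neutral_cong_right) (use finS in \<open>auto simp: adjacency_tensor_def\<close>)
  also have "\<dots> = (\<Sum>e\<in>?E. \<Sum>is\<in>permutations_of_set (e - {i}). prod_list (map x is) / fact (k - 1))"
    unfolding eq
  proof (rule sum.UNION_disjoint)
    show "\<forall>e\<in>?E. \<forall>e'\<in>?E. e \<noteq> e' \<longrightarrow>
        permutations_of_set (e - {i}) \<inter> permutations_of_set (e' - {i}) = {}"
      by (auto simp: permutations_of_set_def)
  qed (use finE in auto)
  also have "\<dots> = (\<Sum>e\<in>?E. prod x (e - {i}))"
  proof (rule sum.cong[OF refl])
    fix e assume e: "e \<in> ?E"
    have "(\<Sum>is\<in>permutations_of_set (e - {i}). prod_list (map x is) / fact (k - 1)) =
          (\<Sum>is\<in>permutations_of_set (e - {i}). prod x (e - {i}) / fact (k - 1))"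
    proof (rule sum.cong[OF refl])
      fix xs assume "xs \<in> permutations_of_set (e - {i})"
      then have "set xs = e - {i}" "distinct xs" by (simp_all add: permutations_of_set_def)
      then show "prod_list (map x xs) / fact (k - 1) = prod x (e - {i}) / fact (k - 1)"
        using prod.distinct_set_conv_list[of xs x] by simp
    qed
    also have "\<dots> = prod x (e - {i})"
      using e fe[OF e] E by simp
    finally show "(\<Sum>is\<in>permutations_of_set (e - {i}). prod_list (map x is) / fact (k - 1)) =
          prod x (e - {i})" .
  qed
  finally show ?thesis .
qed

lemma eigenvalue_iff:
  assumes "uniform_hypergraph k G" and "k \<ge> 1"
  shows "eigenvalue k G lam \<longleftrightarrow>
     (\<exists>x. (\<exists>i \<in> verts G. x i \<noteq> 0) \<and>
        (\<forall>i \<in> verts G. (\<Sum>e \<in> {e \<in> edges G. i \<in> e}. prod x (e - {i})) = lam * x i ^ (k - 1)))"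
  unfolding eigenvalue_def adjacency_tensor_apply[OF assms] ..

text \<open>The indicator vector of \<open>v\<close> is an eigenvector, because each product runs
  over \<open>k - 1\<close> vertices, at least two, and so meets a zero. This makes the set of
  moduli nonempty, which a bound on its supremum requires.\<close>

lemma eigenvalue_zero:
  assumes G: "uniform_hypergraph k G" and k: "k \<ge> 3" and v: "v \<in> verts G"
  shows "eigenvalue k G 0"
proof -
  define x :: "'a \<Rightarrow> complex" where "x = (\<lambda>w. if w = v then 1 else 0)"
  have "prod x (e - {i}) = 0" if "e \<in> edges G" "i \<in> e" for e i
  proof -
    have c: "card e = k" using that G by (auto simp: uniform_hypergraph_def)
    then have fin: "finite e" using k by (intro card_ge_0_finite) simp
    have "\<not> e \<subseteq> {i, v}"
    proof
      assume "e \<subseteq> {i, v}"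
      then have "card e \<le> card {i, v}" by (intro card_mono) auto
      then show False using c k card_insert_le_m1[of 2 "{v}" i] by (simp split: if_splits)
    qed
    then obtain w where "w \<in> e" "w \<notin> {i, v}" by blast
    then have "w \<in> e - {i}" "x w = 0" by (auto simp: x_def)
    then show ?thesis using fin by (meson finite_Diff prod_zero)
  qed
  then have "(\<Sum>e \<in> {e \<in> edges G. i \<in> e}. prod x (e - {i})) = 0" for i
    by simp
  moreover have "x v \<noteq> 0" by (simp add: x_def)
  ultimately show ?thesis using v k by (subst eigenvalue_iff[OF G]) (auto intro!: exI[of _ x])
qed

section \<open>Isomorphism invariance of the spectral radius\<close>

lemma hypergraph_iso_sym:
  assumes iso: "hypergraph_iso G G'" and G: "uniform_hypergraph k G"
  shows "hypergraph_iso G' G"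
proof -
  obtain f where f: "bij_betw f (verts G) (verts G')" and E: "(\<lambda>e. f ` e) ` edges G = edges G'"
    using iso by (auto simp: hypergraph_iso_def)
  let ?g = "inv_into (verts G) f"
  have "?g ` f ` e = e" if "e \<in> edges G" for e
    using that G f by (intro inv_into_image_cancel) (auto simp: uniform_hypergraph_def bij_betw_def)
  then have "(\<lambda>e. ?g ` e) ` edges G' = edges G"
    unfolding E[symmetric] image_image by simp
  then show ?thesis
    unfolding hypergraph_iso_def using bij_betw_inv_into[OF f] by blast
qed

lemma hypergraph_iso_trans:
  assumes "hypergraph_iso G G'" and "hypergraph_iso G' G''"
  shows "hypergraph_iso G G''"
proof -
  obtain f g where f: "bij_betw f (verts G) (verts G')" "(\<lambda>e. f ` e) ` edges G = edges G'"
    and g: "bij_betw g (verts G') (verts G'')" "(\<lambda>e. g ` e) ` edges G' = edges G''"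
    using assms by (auto simp: hypergraph_iso_def)
  have "(\<lambda>e. (g \<circ> f) ` e) ` edges G = edges G''"
    unfolding g(2)[symmetric] f(2)[symmetric] by (simp add: image_image image_comp)
  then show ?thesis
    unfolding hypergraph_iso_def using bij_betw_trans[OF f(1) g(1)] by blast
qed

lemma inj_on_edge_image:
  assumes "uniform_hypergraph k G" and "inj_on f (verts G)"
  shows "inj_on (\<lambda>e. f ` e) (edges G)"
proof (rule inj_onI)
  fix e e' assume "e \<in> edges G" "e' \<in> edges G" "f ` e = f ` e'"
  then show "e = e'"
    using inj_on_image_eq_iff[OF assms(2), of e e'] assms(1) by (simp add: uniform_hypergraph_def subset_iff)
qed

text \<open>An eigenvector of \<open>G'\<close> is pulled back along the bijection. The converse
  direction comes from the inverse isomorphism.\<close>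

lemma eigenvalue_iso:
  assumes iso: "hypergraph_iso G G'" and G: "uniform_hypergraph k G"
    and G': "uniform_hypergraph k G'" and k: "k \<ge> 1" and ev: "eigenvalue k G' lam"
  shows "eigenvalue k G lam"
proof -
  obtain f where f: "bij_betw f (verts G) (verts G')" and E: "(\<lambda>e. f ` e) ` edges G = edges G'"
    using iso by (auto simp: hypergraph_iso_def)
  have inj: "inj_on f (verts G)" using f by (simp add: bij_betw_def)
  have sub: "e \<subseteq> verts G" if "e \<in> edges G" for e
    using that G by (auto simp: uniform_hypergraph_def)
  obtain x where x: "\<exists>i \<in> verts G'. x i \<noteq> 0"
    and eq: "\<forall>i \<in> verts G'. (\<Sum>e \<in> {e \<in> edges G'. i \<in> e}. prod x (e - {i})) = lam * x i ^ (k - 1)"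
    using ev unfolding eigenvalue_iff[OF G' k] by blast
  have "(\<Sum>e \<in> {e \<in> edges G. i \<in> e}. prod (x \<circ> f) (e - {i})) = lam * (x \<circ> f) i ^ (k - 1)"
    if i: "i \<in> verts G" for i
  proof -
    have "f i \<in> verts G'" using f i by (auto simp: bij_betw_def)
    then have "lam * (x \<circ> f) i ^ (k - 1) = (\<Sum>e \<in> {e \<in> edges G'. f i \<in> e}. prod x (e - {f i}))"
      using eq by simp
    also have "{e \<in> edges G'. f i \<in> e} = (\<lambda>e. f ` e) ` {e \<in> edges G. i \<in> e}"
      using inj i sub unfolding E[symmetric] by (auto dest: inj_onD)
    also have "(\<Sum>e \<in> (\<lambda>e. f ` e) ` {e \<in> edges G. i \<in> e}. prod x (e - {f i})) =
        (\<Sum>e \<in> {e \<in> edges G. i \<in> e}. prod x (f ` e - {f i}))"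
      by (subst sum.reindex)
        (auto intro: inj_on_subset[OF inj_on_edge_image[OF G inj]])
    also have "\<dots> = (\<Sum>e \<in> {e \<in> edges G. i \<in> e}. prod (x \<circ> f) (e - {i}))"
    proof (rule sum.cong[OF refl])
      fix e assume e: "e \<in> {e \<in> edges G. i \<in> e}"
      then have "f ` e - {f i} = f ` (e - {i})"
        using inj_on_image_set_diff[OF inj, of e "{i}"] sub by auto
      moreover have "inj_on f (e - {i})" using e sub by (auto intro: inj_on_subset[OF inj])
      ultimately show "prod x (f ` e - {f i}) = prod (x \<circ> f) (e - {i})"
        by (simp add: prod.reindex)
    qed
    finally show ?thesis by simp
  qed
  moreover have "\<exists>i \<in> verts G. (x \<circ> f) i \<noteq> 0"
    using x f by (force simp: bij_betw_def)
  ultimately show ?thesis unfolding eigenvalue_iff[OF G k] by blast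
qed

lemma spectral_radius_iso:
  assumes "hypergraph_iso G G'" and "uniform_hypergraph k G" and "uniform_hypergraph k G'"
    and "k \<ge> 1"
  shows "spectral_radius k G = spectral_radius k G'"
proof -
  have "eigenvalue k G = eigenvalue k G'"
    using eigenvalue_iso[OF assms]
      eigenvalue_iso[OF hypergraph_iso_sym[OF assms(1,2)] assms(3,2,4)] by blast
  then show ?thesis by (simp add: spectral_radius_def)
qed

section \<open>Eigenvalues of power hypergraphs\<close>

text \<open>The edge of the power that replaces \<open>e\<close>. As \<open>e\<close> can be read
  off from it, sums over edges of the power become sums over edges of \<open>H\<close>.\<close>

definition power_edge :: "nat \<Rightarrow> 'a set \<Rightarrow> ('a + 'a set \<times> nat) set" where
  "power_edge k e = Inl ` e \<union> Inr ` ({e} \<times> {1..k - 2})"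

lemma verts_power: "verts (power_of_graph H k) = Inl ` verts H \<union> Inr ` (edges H \<times> {1..k - 2})"
  and edges_power: "edges (power_of_graph H k) = power_edge k ` edges H"
  by (simp_all add: power_of_graph_def power_edge_def)

lemma Inl_in_power_edge [simp]: "Inl v \<in> power_edge k e \<longleftrightarrow> v \<in> e"
  and Inr_in_power_edge [simp]: "Inr (e', j) \<in> power_edge k e \<longleftrightarrow> e' = e \<and> j \<in> {1..k - 2}"
  by (auto simp: power_edge_def)

lemma inj_power_edge: "inj_on (power_edge k) E"
  by (rule inj_onI) (metis Inl_in_power_edge subsetI subset_antisym)

lemma prod_power_edge:
  assumes "finite e"
  shows "prod x (power_edge k e) = (\<Prod>v\<in>e. x (Inl v)) * (\<Prod>j\<in>{1..k - 2}. x (Inr (e, j)))"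
proof -
  have "power_edge k e = Inl ` e \<union> (\<lambda>j. Inr (e, j)) ` {1..k - 2}"
    by (auto simp: power_edge_def)
  moreover have "prod x (Inl ` e \<union> (\<lambda>j. Inr (e, j)) ` {1..k - 2}) =
     prod x (Inl ` e) * prod x ((\<lambda>j. Inr (e, j)) ` {1..k - 2})"
    using assms by (intro prod.union_disjoint) auto
  moreover have "prod x (Inl ` e) = (\<Prod>v\<in>e. x (Inl v))"
    by (simp add: prod.reindex)
  moreover have "prod x ((\<lambda>j. Inr (e, j)) ` {1..k - 2}) = (\<Prod>j\<in>{1..k - 2}. x (Inr (e, j)))"
    by (subst prod.reindex) (auto simp: inj_on_def)
  ultimately show ?thesis by (simp only:)
qed

lemma simple_graphD:
  assumes "simple_graph H"
  shows "finite (verts H)" "finite (edges H)"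
    "\<And>e. e \<in> edges H \<Longrightarrow> e \<subseteq> verts H \<and> card e = 2 \<and> finite e"
proof -
  show f: "finite (verts H)" using assms by (simp add: uniform_hypergraph_def)
  show *: "\<And>e. e \<in> edges H \<Longrightarrow> e \<subseteq> verts H \<and> card e = 2 \<and> finite e"
    using assms f by (auto simp: uniform_hypergraph_def intro: finite_subset)
  show "finite (edges H)"
    by (rule finite_subset[of _ "Pow (verts H)"]) (use * f in auto)
qed

lemma card_power_edge:
  assumes "card e = 2" and "k \<ge> 2"
  shows "card (power_edge k e) = k"
proof -
  have "finite e" using assms by (intro card_ge_0_finite) simp
  then have "card (power_edge k e) = card (Inl ` e :: ('a + 'a set \<times> nat) set)
      + card (Inr ` ({e} \<times> {1..k - 2}) :: ('a + 'a set \<times> nat) set)"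
    unfolding power_edge_def by (intro card_Un_disjoint) auto
  also have "\<dots> = 2 + (k - 2)"
    using assms by (simp add: card_image card_cartesian_product)
  finally show ?thesis using assms by simp
qed

lemma uniform_power:
  assumes H: "simple_graph H" and k: "k \<ge> 2"
  shows "uniform_hypergraph k (power_of_graph H k)"
proof -
  note H' = simple_graphD[OF H]
  have "power_edge k e \<subseteq> verts (power_of_graph H k)" if "e \<in> edges H" for e
    using H'(3)[OF that] that by (auto simp: verts_power power_edge_def)
  moreover have "finite (verts (power_of_graph H k))" using H' by (simp add: verts_power)
  ultimately show ?thesis
    using H'(3) k by (auto simp: uniform_hypergraph_def edges_power card_power_edge)
qed

lemma card_edges_power: "card (edges (power_of_graph H k)) = card (edges H)"
  by (simp add: edges_power card_image inj_power_edge)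

lemma card_verts_power:
  assumes "simple_graph H"
  shows "card (verts (power_of_graph H k)) = card (verts H) + card (edges H) * (k - 2)"
proof -
  note H' = simple_graphD[OF assms]
  have "card (verts (power_of_graph H k)) =
     card (Inl ` verts H :: ('a + 'a set \<times> nat) set)
     + card (Inr ` (edges H \<times> {1..k - 2}) :: ('a + 'a set \<times> nat) set)"
    unfolding verts_power using H' by (intro card_Un_disjoint) auto
  then show ?thesis by (simp add: card_image card_cartesian_product)
qed

lemma power_edges_at:
  "{f \<in> edges (power_of_graph H k). w \<in> f} = power_edge k ` {e \<in> edges H. w \<in> power_edge k e}"
  by (auto simp: edges_power)

text \<open>Double counting: every edge is met once from each of its two ends.\<close>

lemma sum_over_vertices_of_edges:
  assumes H: "simple_graph H"
  shows "(\<Sum>v\<in>verts H. \<Sum>e\<in>{e \<in> edges H. v \<in> e}. g e) = 2 * (\<Sum>e\<in>edges H. g e :: real)"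
proof -
  note H' = simple_graphD[OF H]
  have "(\<Sum>v\<in>verts H. \<Sum>e\<in>{e \<in> edges H. v \<in> e}. g e) =
        (\<Sum>e\<in>edges H. \<Sum>v\<in>{v \<in> verts H. v \<in> e}. g e)"
    using H' by (intro sum.swap_restrict)
  also have "\<dots> = (\<Sum>e\<in>edges H. 2 * g e)"
  proof (rule sum.cong[OF refl])
    fix e assume e: "e \<in> edges H"
    then have "{v \<in> verts H. v \<in> e} = e" using H'(3) by auto
    then show "(\<Sum>v\<in>{v \<in> verts H. v \<in> e}. g e) = 2 * g e" using H'(3)[OF e] by simp
  qed
  finally show ?thesis by (simp add: sum_distrib_left)
qed

text \<open>Multiplying the eigenvalue equation at a vertex \<open>w\<close> by \<open>x w\<close> makes both sides homogeneous
  in the edge products. The equations at the \<open>k - 2\<close> new vertices of an edge then determine the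
  modulus of that edge's product, and \<open>y v = sqrt (cmod (x v)) ^ k\<close> is a test vector on \<open>H\<close>.\<close>

lemma eigenvalue_power_bound:
  assumes H: "simple_graph H" and k: "k \<ge> 3" and mu: "0 \<le> mu"
    and ev: "eigenvalue k (power_of_graph H k) lam"
    and bnd: "\<And>y. (\<forall>v. 0 \<le> y v) \<Longrightarrow>
        2 * (\<Sum>e\<in>edges H. prod y e) \<le> mu * (\<Sum>v\<in>verts H. (y v)\<^sup>2)"
  shows "cmod lam \<le> (root k mu)\<^sup>2"
proof (cases "lam = 0")
  case False
  note H' = simple_graphD[OF H]
  let ?P = "power_of_graph H k"
  have U: "uniform_hypergraph k ?P" and k1: "k \<ge> 1" using uniform_power[OF H] k by auto
  have pow_split: "a\<^sup>2 * a ^ (k - 2) = a ^ k" for a :: real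
    using k by (subst power_add[symmetric], subst le_add_diff_inverse) simp_all
  have pow_comm: "(a ^ n)\<^sup>2 = (a\<^sup>2) ^ n" for a :: real and n
    by (simp add: power_mult[symmetric] mult.commute)
  obtain x where x0: "\<exists>w \<in> verts ?P. x w \<noteq> 0"
    and x: "\<And>w. w \<in> verts ?P \<Longrightarrow>
      (\<Sum>e \<in> {e \<in> edges ?P. w \<in> e}. prod x (e - {w})) = lam * x w ^ (k - 1)"
    using ev unfolding eigenvalue_iff[OF U k1] by blast
  define X where "X e = prod x (power_edge k e)" for e
  have eqn: "lam * x w ^ k = (\<Sum>e \<in> {e \<in> edges H. w \<in> power_edge k e}. X e)"
    if w: "w \<in> verts ?P" for w
  proof -
    have "lam * x w ^ k = x w * (lam * x w ^ (k - 1))"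
      using k by (cases k) auto
    also have "\<dots> = (\<Sum>f \<in> {f \<in> edges ?P. w \<in> f}. x w * prod x (f - {w}))"
      by (simp only: sum_distrib_left[symmetric] x[OF w])
    also have "\<dots> = (\<Sum>f \<in> {f \<in> edges ?P. w \<in> f}. prod x f)"
    proof (rule sum.cong[OF refl])
      fix f assume f: "f \<in> {f \<in> edges ?P. w \<in> f}"
      then have "card f = k" using U by (auto simp: uniform_hypergraph_def)
      then have "finite f" using k by (intro card_ge_0_finite) simp
      then show "x w * prod x (f - {w}) = prod x f" using f by (simp flip: prod.remove)
    qed
    also have "\<dots> = (\<Sum>e \<in> {e \<in> edges H. w \<in> power_edge k e}. X e)"
      unfolding power_edges_at by (simp add: sum.reindex inj_power_edge X_def)
    finally show ?thesis .
  qed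
  define L where "L = cmod lam"
  have L: "L > 0" using False by (simp add: L_def)
  define l where "l = sqrt L"
  have l: "l > 0" "l\<^sup>2 = L" using L by (auto simp: l_def)
  \<comment> \<open>Square roots keep all exponents natural: with \<open>y v = s v ^ k\<close>
    below, \<open>(y v)\<^sup>2\<close> is \<open>cmod (x (Inl v)) ^ k\<close>. Likewise
    \<open>l\<close> is the square root of \<open>cmod lam\<close>.\<close>
  define s where "s v = sqrt (cmod (x (Inl v)))" for v
  have s: "s v \<ge> 0" "(s v)\<^sup>2 = cmod (x (Inl v))" for v by (auto simp: s_def)
  define T where "T e = (\<Prod>j\<in>{1..k - 2}. cmod (x (Inr (e, j))))" for e
  have modX: "cmod (X e) = (prod s e)\<^sup>2 * T e" if "e \<in> edges H" for e
    using H'(3)[OF that]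
    by (simp add: X_def prod_power_edge norm_mult prod_norm[symmetric] T_def s(2)[symmetric]
        prod_power_distrib)
  have newv: "L * cmod (x (Inr (e, j))) ^ k = cmod (X e)" if "e \<in> edges H" "j \<in> {1..k - 2}" for e j
  proof -
    have "{e' \<in> edges H. Inr (e, j) \<in> power_edge k e'} = {e}" using that by auto
    moreover have "Inr (e, j) \<in> verts ?P" using that by (simp add: verts_power)
    ultimately have "lam * x (Inr (e, j)) ^ k = X e" using eqn by fastforce
    then show ?thesis by (metis L_def norm_mult norm_power)
  qed
  \<comment> \<open>Multiplying \<open>newv\<close> over all \<open>j\<close> gives
    \<open>L ^ (k - 2) * T e ^ k = ((prod s e)\<^sup>2 * T e) ^ (k - 2)\<close>. Cancelling
    \<open>T e ^ (k - 2)\<close> and taking square roots gives equality. If \<open>T e = 0\<close>,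
    only the inequality survives.\<close>
  have Tbound: "l ^ (k - 2) * T e \<le> prod s e ^ (k - 2)" if e: "e \<in> edges H" for e
  proof (cases "T e = 0")
    case True
    then show ?thesis using s by (simp add: prod_nonneg)
  next
    case False
    have "(\<Prod>j\<in>{1..k - 2}. L * cmod (x (Inr (e, j))) ^ k) = (\<Prod>j\<in>{1..k - 2}. (prod s e)\<^sup>2 * T e)"
      using newv[OF e] modX[OF e] by (intro prod.cong) auto
    then have "L ^ (k - 2) * T e ^ k = ((prod s e)\<^sup>2 * T e) ^ (k - 2)"
      by (simp add: prod.distrib T_def prod_power_distrib)
    moreover have "T e ^ k = T e ^ (k - 2) * (T e)\<^sup>2"
      using pow_split[of "T e"] by (simp add: mult.commute)
    ultimately have "(T e ^ (k - 2)) * (L ^ (k - 2) * (T e)\<^sup>2) = T e ^ (k - 2) * ((prod s e)\<^sup>2) ^ (k - 2)"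
      by (simp add: power_mult_distrib mult_ac)
    then have "L ^ (k - 2) * (T e)\<^sup>2 = ((prod s e)\<^sup>2) ^ (k - 2)" using False by simp
    then have "(l ^ (k - 2) * T e)\<^sup>2 = (prod s e ^ (k - 2))\<^sup>2"
      by (simp only: power_mult_distrib pow_comm l(2))
    then show ?thesis
      by (rule power2_le_imp_le[OF eq_refl]) (simp add: prod_nonneg s)
  qed
  define y where "y = (\<lambda>v. s v ^ k)"
  have edge: "l ^ (k - 2) * cmod (X e) \<le> prod y e" if e: "e \<in> edges H" for e
  proof -
    have "l ^ (k - 2) * cmod (X e) = (prod s e)\<^sup>2 * (l ^ (k - 2) * T e)"
      by (simp add: modX[OF e])
    also have "\<dots> \<le> (prod s e)\<^sup>2 * prod s e ^ (k - 2)"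
      by (intro mult_left_mono Tbound[OF e]) simp
    also have "\<dots> = prod y e"
      by (simp only: pow_split y_def prod_power_distrib[symmetric])
    finally show ?thesis .
  qed
  \<comment> \<open>The equation at an original vertex, scaled by \<open>l ^ (k - 2)\<close>; the
    triangle inequality and \<open>edge\<close> replace the complex edge products by those of
    \<open>y\<close>.\<close>
  have vert: "l ^ k * (y v)\<^sup>2 \<le> (\<Sum>e\<in>{e \<in> edges H. v \<in> e}. prod y e)" if v: "v \<in> verts H" for v
  proof -
    have "l ^ k = l ^ (k - 2) * L" using pow_split[of l] l(2) by (simp add: mult.commute)
    moreover have "(y v)\<^sup>2 = cmod (x (Inl v)) ^ k"
      by (simp only: y_def pow_comm s(2))
    ultimately have "l ^ k * (y v)\<^sup>2 = l ^ (k - 2) * cmod (lam * x (Inl v) ^ k)"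
      by (simp add: L_def norm_mult norm_power)
    also have "\<dots> = l ^ (k - 2) * cmod (\<Sum>e\<in>{e \<in> edges H. v \<in> e}. X e)"
      using eqn[of "Inl v"] v by (simp add: verts_power)
    also have "\<dots> \<le> l ^ (k - 2) * (\<Sum>e\<in>{e \<in> edges H. v \<in> e}. cmod (X e))"
      using l by (intro mult_left_mono norm_sum) simp
    also have "\<dots> \<le> (\<Sum>e\<in>{e \<in> edges H. v \<in> e}. prod y e)"
      unfolding sum_distrib_left by (intro sum_mono edge) simp
    finally show ?thesis .
  qed
  have "l ^ k * (\<Sum>v\<in>verts H. (y v)\<^sup>2) \<le> (\<Sum>v\<in>verts H. \<Sum>e\<in>{e \<in> edges H. v \<in> e}. prod y e)"
    unfolding sum_distrib_left by (intro sum_mono vert)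
  also have "\<dots> = 2 * (\<Sum>e\<in>edges H. prod y e)" by (rule sum_over_vertices_of_edges[OF H])
  also have "\<dots> \<le> mu * (\<Sum>v\<in>verts H. (y v)\<^sup>2)"
    using s by (intro bnd) (simp add: y_def)
  finally have le: "l ^ k * (\<Sum>v\<in>verts H. (y v)\<^sup>2) \<le> mu * (\<Sum>v\<in>verts H. (y v)\<^sup>2)" .
  \<comment> \<open>If \<open>x\<close> vanished on the original vertices, every edge product would
    be zero, and \<open>newv\<close> with \<open>L > 0\<close> would make \<open>x\<close> vanish on
    the new vertices too. So \<open>y\<close> is a nonzero test vector and its norm can be
    cancelled.\<close>
  have "\<exists>v\<in>verts H. x (Inl v) \<noteq> 0"
  proof (rule ccontr)
    assume "\<not> ?thesis"
    then have z: "x (Inl v) = 0" if "v \<in> verts H" for v using that by blast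
    have "x (Inr (e, j)) = 0" if e: "e \<in> edges H" and j: "j \<in> {1..k - 2}" for e j
    proof -
      obtain v where "v \<in> e" using H'(3)[OF e] by fastforce
      then have "s v = 0" "v \<in> e" using z H'(3)[OF e] by (auto simp: s_def)
      then have "prod s e = 0" using H'(3)[OF e] by (meson prod_zero)
      then have "L * cmod (x (Inr (e, j))) ^ k = 0" using newv[OF e j] modX[OF e] by simp
      then show ?thesis using L by simp
    qed
    then show False using x0 z by (auto simp: verts_power)
  qed
  then obtain v where v: "v \<in> verts H" "y v \<noteq> 0" by (auto simp: y_def s_def)
  then have "(\<Sum>v\<in>verts H. (y v)\<^sup>2) > 0"
    using H'(1) by (intro sum_pos2[of _ v]) auto
  then have "l ^ k \<le> mu" using le by simp
  then have "root k (l ^ k) \<le> root k mu" using k by simp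
  then have "l \<le> root k mu" using k l by (simp add: real_root_power_cancel)
  then have "l\<^sup>2 \<le> (root k mu)\<^sup>2" using l by (intro power_mono) auto
  then show ?thesis using l by (simp add: L_def)
qed simp

text \<open>The counterpart of the upper bound: a positive eigenvector of \<open>H\<close> extends
  to the new vertices, which shows that the bound is attained.\<close>

lemma eigenvalue_power_of_eigenvector:
  assumes H: "simple_graph H" and k: "k \<ge> 3" and rho: "0 < rho"
    and ne: "verts H \<noteq> {}" and h: "\<And>v. 0 < h v"
    and eig: "\<And>v. v \<in> verts H \<Longrightarrow> (\<Sum>e\<in>{e \<in> edges H. v \<in> e}. prod h (e - {v})) = rho * h v"
  shows "eigenvalue k (power_of_graph H k) (complex_of_real ((root k rho)\<^sup>2))"
proof -
  note H' = simple_graphD[OF H]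
  let ?P = "power_of_graph H k"
  have U: "uniform_hypergraph k ?P" and k1: "k \<ge> 1" using uniform_power[OF H] k by auto
  have pow_split: "a\<^sup>2 * a ^ (k - 2) = a ^ k" for a :: real
    using k by (subst power_add[symmetric], subst le_add_diff_inverse) simp_all
  define r where "r = root k rho"
  have r: "r > 0" "r ^ k = rho" using k rho by (auto simp: r_def real_root_pow_pos)
  define s where "s v = root k (h v)" for v
  have s: "s v > 0" "s v ^ k = h v" for v using k h by (auto simp: s_def real_root_pow_pos)
  have ps: "prod s e > 0" for e using s by (simp add: prod_pos)
  \<comment> \<open>On original vertices \<open>x\<close> is \<open>h\<close> to the power
    \<open>2 / k\<close>. At a new vertex with value \<open>t\<close>, the same on all new vertices
    of \<open>e\<close>, the equation reads
    \<open>r\<^sup>2 * t ^ k = (prod s e)\<^sup>2 * t ^ (k - 2)\<close>, whence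
    \<open>t = prod s e / r\<close>.\<close>
  define x where "x w = (case w of Inl v \<Rightarrow> (s v)\<^sup>2 | Inr (e, j) \<Rightarrow> prod s e / r)" for w :: "'a + 'a set \<times> nat"
  have "s v \<noteq> 0" for v using s(1)[of v] by simp
  then have xpos: "x w > 0" for w using r ps by (auto simp: x_def split: sum.splits prod.splits)
  have X: "prod x (power_edge k e) = r\<^sup>2 / rho * prod h e" if "e \<in> edges H" for e
  proof -
    have "prod x (power_edge k e) = (prod s e)\<^sup>2 * (prod s e / r) ^ (k - 2)"
      using H'(3)[OF that] by (simp add: prod_power_edge x_def prod_power_distrib)
    also have "\<dots> = prod s e ^ k / r ^ (k - 2)"
      by (simp only: power_divide times_divide_eq_right pow_split)
    also have "prod s e ^ k = prod h e" by (simp add: prod_power_distrib s)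
    also have "r ^ (k - 2) = rho / r\<^sup>2"
      using r k by (simp add: power_diff)
    finally show ?thesis by simp
  qed
  \<comment> \<open>The equation at \<open>w\<close> multiplied by \<open>x w\<close>. At original
    vertices it reduces to the eigenvector equation of \<open>h\<close>, at new ones to the choice
    of \<open>x\<close>.\<close>
  have key: "r\<^sup>2 * x w ^ k = (\<Sum>e \<in> {e \<in> edges H. w \<in> power_edge k e}. prod x (power_edge k e))"
    if w: "w \<in> verts ?P" for w
  proof -
    have "(\<Sum>e \<in> {e \<in> edges H. w \<in> power_edge k e}. prod x (power_edge k e)) =
       r\<^sup>2 / rho * (\<Sum>e \<in> {e \<in> edges H. w \<in> power_edge k e}. prod h e)"
      unfolding sum_distrib_left by (intro sum.cong refl X) simp
    also have "\<dots> = r\<^sup>2 * x w ^ k"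
      using w unfolding verts_power
    proof (elim UnE imageE)
      fix v assume v: "v \<in> verts H" "w = Inl v"
      have "(\<Sum>e \<in> {e \<in> edges H. v \<in> e}. prod h e) = (\<Sum>e \<in> {e \<in> edges H. v \<in> e}. h v * prod h (e - {v}))"
        using H'(3) by (intro sum.cong) (auto simp: prod.remove)
      also have "\<dots> = h v * (rho * h v)" by (simp add: eig[OF v(1)] flip: sum_distrib_left)
      finally show ?thesis
        using v rho by (simp add: x_def power2_eq_square power_mult_distrib s)
    next
      fix p assume "p \<in> edges H \<times> {1..k - 2}" "w = Inr p"
      then obtain e j where e: "e \<in> edges H" "j \<in> {1..k - 2}" "w = Inr (e, j)" by auto
      have "{e' \<in> edges H. w \<in> power_edge k e'} = {e}" using e by auto
      moreover have "prod s e ^ k = prod h e" by (simp add: prod_power_distrib s)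
      ultimately show ?thesis
        using e r(2) by (simp add: x_def power_divide)
    qed
    finally show ?thesis by simp
  qed
  have "(\<Sum>e \<in> {e \<in> edges ?P. w \<in> e}. prod x (e - {w})) = r\<^sup>2 * x w ^ (k - 1)"
    if w: "w \<in> verts ?P" for w
  proof -
    have "x w * (\<Sum>e \<in> {e \<in> edges ?P. w \<in> e}. prod x (e - {w})) =
        (\<Sum>f \<in> {f \<in> edges ?P. w \<in> f}. prod x f)"
      unfolding sum_distrib_left
    proof (rule sum.cong[OF refl])
      fix f assume f: "f \<in> {f \<in> edges ?P. w \<in> f}"
      then have "card f = k" using U by (auto simp: uniform_hypergraph_def)
      then have "finite f" using k by (intro card_ge_0_finite) simp
      then show "x w * prod x (f - {w}) = prod x f" using f by (simp flip: prod.remove)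
    qed
    also have "\<dots> = r\<^sup>2 * x w ^ k"
      unfolding power_edges_at key[OF w] by (simp add: sum.reindex inj_power_edge)
    also have "\<dots> = x w * (r\<^sup>2 * x w ^ (k - 1))" using k by (cases k) auto
    finally show ?thesis using xpos[of w] by simp
  qed
  then have "(\<Sum>e \<in> {e \<in> edges ?P. w \<in> e}. \<Prod>v\<in>e - {w}. complex_of_real (x v)) =
      complex_of_real (r\<^sup>2) * complex_of_real (x w) ^ (k - 1)" if "w \<in> verts ?P" for w
    using that by (simp flip: of_real_prod of_real_sum of_real_power of_real_mult)
  moreover have "\<exists>w\<in>verts ?P. complex_of_real (x w) \<noteq> 0"
    using ne xpos unfolding verts_power
    by (metis UnI1 ex_in_conv imageI less_irrefl of_real_eq_0_iff)
  ultimately show ?thesis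
    unfolding r_def[symmetric] eigenvalue_iff[OF U k1]
    by (intro exI[of _ "\<lambda>w. complex_of_real (x w)"]) blast
qed

section \<open>The quadratic form of a connected bicyclic graph\<close>

text \<open>Loops at vertices of edges are included, just as a walk may stay at a vertex; they do
  not change the reflexive transitive closure.\<close>

definition adj :: "'a hypergraph \<Rightarrow> ('a \<times> 'a) set" where
  "adj G = {(a, b). \<exists>e\<in>edges G. a \<in> e \<and> b \<in> e}"

lemma adj_sym: "(a, b) \<in> adj G \<Longrightarrow> (b, a) \<in> adj G"
  by (auto simp: adj_def)

lemma joined_imp_adj_rtrancl:
  assumes "joined G a b"
  shows "(a, b) \<in> (adj G)\<^sup>*"
proof -
  obtain vs es where w: "walk G vs es" and ab: "hd vs = a" "last vs = b"
    using assms by (auto simp: joined_def)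
  have "(vs ! 0, vs ! i) \<in> (adj G)\<^sup>*" if "i \<le> length es" for i
    using that
  proof (induction i)
    case (Suc i)
    then have "es ! i \<in> edges G" "{vs ! i, vs ! Suc i} \<subseteq> es ! i"
      using w by (auto simp: walk_def)
    then have "(vs ! i, vs ! Suc i) \<in> adj G" by (auto simp: adj_def)
    then show ?case using Suc by (meson Suc_leD rtrancl.rtrancl_into_rtrancl)
  qed simp
  moreover have l: "length vs = Suc (length es)" using w by (simp add: walk_def)
  then have "vs \<noteq> []" by auto
  then have "hd vs = vs ! 0" "last vs = vs ! length es"
    using l by (simp_all add: hd_conv_nth last_conv_nth)
  ultimately show ?thesis using ab by auto
qed

lemma adj_rtrancl_imp_joined:
  assumes ab: "(a, b) \<in> (adj G)\<^sup>*" and a: "a \<in> verts G" and G: "uniform_hypergraph k G"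
  shows "joined G a b"
  using ab
proof (induction rule: rtrancl_induct)
  case base
  have "walk G [a] []" using a by (simp add: walk_def)
  then show ?case unfolding joined_def by force
next
  case (step b c)
  then obtain vs es where w: "walk G vs es" and h: "hd vs = a" "last vs = b"
    by (auto simp: joined_def)
  obtain e where e: "e \<in> edges G" "b \<in> e" "c \<in> e" using step by (auto simp: adj_def)
  have l: "length vs = Suc (length es)" using w by (simp add: walk_def)
  then have "vs \<noteq> []" by auto
  then have "vs ! length es = b" using h l by (simp add: last_conv_nth)
  have "c \<in> verts G" using e G by (auto simp: uniform_hypergraph_def)
  then have "walk G (vs @ [c]) (es @ [e])"
    using w e l \<open>vs ! length es = b\<close>
    by (auto simp: walk_def nth_append less_Suc_eq)
  then show ?case
    unfolding joined_def using h \<open>vs \<noteq> []\<close>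
    by (intro exI[of _ "vs @ [c]"] exI[of _ "es @ [e]"]) simp
qed

lemma connected_iff_adj:
  assumes "uniform_hypergraph k G"
  shows "connected_hypergraph G \<longleftrightarrow> (\<forall>a\<in>verts G. \<forall>b\<in>verts G. (a, b) \<in> (adj G)\<^sup>*)"
  using joined_imp_adj_rtrancl adj_rtrancl_imp_joined[OF _ _ assms]
  by (metis connected_hypergraph_def)

text \<open>The parent \<open>p j\<close> is the last vertex before \<open>j\<close> on a shortest
  path from \<open>u\<close>, so it is strictly nearer to \<open>u\<close>. Two vertices with the
  same tree edge would be parents of each other, each nearer than the other. A neighbour of
  \<open>u\<close> has distance 1, so its parent has distance 0 and is \<open>u\<close>.\<close>

lemma bfs_parent:
  assumes H: "simple_graph H" and con: "connected_hypergraph H" and u: "u \<in> verts H"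
  obtains p where "\<And>j. j \<in> verts H - {u} \<Longrightarrow> {j, p j} \<in> edges H \<and> p j \<noteq> j"
    and "inj_on (\<lambda>j. {j, p j}) (verts H - {u})"
    and "\<And>j. {u, j} \<in> edges H \<Longrightarrow> j \<noteq> u \<Longrightarrow> p j = u"
proof -
  define d where "d j = (LEAST n. (u, j) \<in> adj H ^^ n)" for j
  have d: "(u, j) \<in> adj H ^^ d j" if "j \<in> verts H" for j
  proof -
    have "(u, j) \<in> (adj H)\<^sup>*" using con u that connected_iff_adj[OF H] by blast
    then have "\<exists>n. (u, j) \<in> adj H ^^ n" by (simp add: rtrancl_power)
    then show ?thesis unfolding d_def by (rule LeastI_ex)
  qed
  have d_le: "d j \<le> n" if "(u, j) \<in> adj H ^^ n" for j n
    unfolding d_def using that by (rule Least_le)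
  have "\<exists>p. {j, p} \<in> edges H \<and> d p < d j" if j: "j \<in> verts H - {u}" for j
  proof -
    have "d j \<noteq> 0" using d[of j] j by (intro notI) auto
    then obtain n where n: "d j = Suc n" by (cases "d j") auto
    then obtain p where p: "(u, p) \<in> adj H ^^ n" "(p, j) \<in> adj H"
      using d[of j] j by (auto elim: relpow_Suc_E)
    then have lt: "d p < d j" using d_le n by fastforce
    obtain e where e: "e \<in> edges H" "p \<in> e" "j \<in> e" using p by (auto simp: adj_def)
    have "p \<noteq> j" using lt by auto
    then have "e = {j, p}"
      using simple_graphD(3)[OF H e(1)] e by (metis card_2_iff insertE insert_commute singletonD)
    then show ?thesis using e lt by blast
  qed
  then obtain p where p: "\<And>j. j \<in> verts H - {u} \<Longrightarrow> {j, p j} \<in> edges H \<and> d (p j) < d j"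
    by metis
  show ?thesis
  proof
    show "{j, p j} \<in> edges H \<and> p j \<noteq> j" if "j \<in> verts H - {u}" for j
      using p[OF that] by auto
    show "inj_on (\<lambda>j. {j, p j}) (verts H - {u})"
    proof (rule inj_onI)
      fix i j assume "i \<in> verts H - {u}" "j \<in> verts H - {u}" "{i, p i} = {j, p j}"
      then show "i = j" using p[of i] p[of j] by (auto simp: doubleton_eq_iff)
    qed
    show "p j = u" if e: "{u, j} \<in> edges H" "j \<noteq> u" for j
    proof -
      have "(u, j) \<in> adj H ^^ 1" using e by (auto simp: adj_def)
      then have "d j \<le> 1" by (rule d_le)
      moreover have j: "j \<in> verts H - {u}" using simple_graphD(3)[OF H e(1)] e by auto
      ultimately have "d (p j) = 0" using p by fastforce
      moreover have "p j \<in> verts H" using p[OF j] simple_graphD(3)[OF H] by blast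
      ultimately show ?thesis using d[of "p j"] by simp
    qed
  qed
qed

lemma finite_argmax:
  fixes y :: "'a \<Rightarrow> real"
  assumes "finite S" "S \<noteq> {}"
  obtains u where "u \<in> S" "\<And>v. v \<in> S \<Longrightarrow> y v \<le> y u"
proof -
  have "Max (y ` S) \<in> y ` S" using assms by (intro Max_in) auto
  then obtain u where "u \<in> S" "y u = Max (y ` S)" by auto
  then show ?thesis using that assms by (metis Max_ge finite_imageI imageI)
qed

text \<open>The four numbers \<open>1, B, C, D\<close> are the entries of the Perron vector of \<open>H_graph m\<close> at the
  center, at the other vertex of degree 3, at the two vertices of degree 2 and at the leaves;
  \<open>rho\<close> is the eigenvalue.\<close>

locale extremal_weights =
  fixes m :: nat and rho B C D :: real
  assumes m: "m > 5" and rho: "rho > 2" and pos: "0 < B" "0 < C" "0 < D"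
    and center: "B + 2 * C + (real m - 5) * D = rho"
    and deg3: "1 + 2 * C = rho * B" and deg2: "1 + B = rho * C" and leaf: "1 = rho * D"
begin

text \<open>The difference of \<open>center\<close> and \<open>deg3\<close> leaves the leaf
  contribution on one side. In the equality case below this makes the center the only vertex of
  maximal weight.\<close>

lemma B_less_1: "B < 1"
proof -
  have "(rho + 1) * (1 - B) = (real m - 5) * D"
    using center deg3 by (simp add: algebra_simps)
  also have "\<dots> > 0" using m pos by simp
  finally show ?thesis using rho by (simp add: zero_less_mult_iff)
qed

text \<open>The difference of \<open>deg3\<close> and \<open>deg2\<close>. In the equality case it
  forces both edges outside the tree through the vertex of second largest weight.\<close>

lemma C_less_B: "C < B"
proof -
  have "(rho + 1) * (B - C) = C" using deg2 deg3 by (simp add: algebra_simps)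
  then have "(rho + 1) * (B - C) > 0" using pos by simp
  then show ?thesis using rho by (simp add: zero_less_mult_iff)
qed

text \<open>\<open>F\<close> is the form of the extremal graph with center \<open>u\<close>, second
  vertex of degree 3 \<open>b\<close>, and \<open>c\<close>, \<open>d\<close> of degree 2. For a
  positive eigenvector \<open>h\<close>, the defect \<open>rho * N - F\<close> is the sum over edges
  \<open>{i, j}\<close> of \<open>h i * h j * (y i / h i - y j / h j)\<^sup>2\<close>. It is
  nonnegative, and zero only if \<open>y\<close> is proportional to \<open>h\<close>.\<close>

lemma extremal_form:
  assumes V: "finite V" "card V = m - 1" and sub: "{u, b, c, d} \<subseteq> V" and dist: "distinct [u, b, c, d]"
    and F: "F = 2 * ((\<Sum>j\<in>V - {u}. y u * y j) + y b * y c + y b * y d)"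
    and N: "N = (\<Sum>v\<in>V. (y v)\<^sup>2)"
  shows "F \<le> rho * N"
    and "F = rho * N \<Longrightarrow> y b = B * y u \<and> y c = C * y u \<and> y d = C * y u \<and>
           (\<forall>j\<in>V - {u, b, c, d}. y j = D * y u)"
proof -
  define R where "R = V - {u, b, c, d}"
  have R: "finite R" "V = {u, b, c, d} \<union> R" "{u, b, c, d} \<inter> R = {}"
    using V sub by (auto simp: R_def)
  have "card R = m - 5"
    unfolding R_def using V sub dist by (subst card_Diff_subset) auto
  then have cR: "real (card R) = real m - 5" using m by simp
  have "V - {u} = {b, c, d} \<union> R" using R dist by auto
  then have F': "F = 2 * (y u * (y b + y c + y d) + (\<Sum>j\<in>R. y u * y j) + y b * y c + y b * y d)"
    unfolding F using R dist by (subst \<open>V - {u} = _\<close>, subst sum.union_disjoint) (auto simp: algebra_simps)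
  have N': "N = (y u)\<^sup>2 + (y b)\<^sup>2 + (y c)\<^sup>2 + (y d)\<^sup>2 + (\<Sum>j\<in>R. (y j)\<^sup>2)"
    unfolding N using R dist by (subst R(2), subst sum.union_disjoint) auto
  \<comment> \<open>The squares for the five edges among \<open>u, b, c, d\<close>, multiplied by
    \<open>B * C\<close> to clear denominators.\<close>
  define M where "M = C * (y b - B * y u)\<^sup>2 + B * (y c - C * y u)\<^sup>2 + B * (y d - C * y u)\<^sup>2
      + (C * y b - B * y c)\<^sup>2 + (C * y b - B * y d)\<^sup>2"
  \<comment> \<open>The squares for the pendant edges; their factor \<open>1 / D\<close> equals
    \<open>rho\<close> by \<open>leaf\<close>.\<close>
  have S: "(\<Sum>j\<in>R. rho * (y j - D * y u)\<^sup>2) =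
      rho * (\<Sum>j\<in>R. (y j)\<^sup>2) - 2 * (\<Sum>j\<in>R. y u * y j) + (real m - 5) * D * (y u)\<^sup>2"
  proof -
    have "rho * (y j - D * y u)\<^sup>2 = rho * (y j)\<^sup>2 - 2 * (y u * y j) + D * (y u)\<^sup>2" for j
    proof -
      have "rho * (y j - D * y u)\<^sup>2 =
          rho * (y j)\<^sup>2 - 2 * (rho * D) * (y u * y j) + (rho * D) * D * (y u)\<^sup>2"
        by (simp add: power2_eq_square algebra_simps)
      then show ?thesis using leaf by simp
    qed
    then show ?thesis
      by (simp add: sum.distrib sum_subtractf sum_distrib_left cR)
  qed
  \<comment> \<open>The eigenvector equations turn the diagonal coefficients at the four core
    vertices into sums over neighbours. The identity that follows is then pure expansion.\<close>
  have "B * C * (rho * (y u)\<^sup>2 + rho * (y b)\<^sup>2 + rho * (y c)\<^sup>2 + rho * (y d)\<^sup>2)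
      = B * C * rho * (y u)\<^sup>2 + (rho * B) * C * (y b)\<^sup>2 + (rho * C) * B * ((y c)\<^sup>2 + (y d)\<^sup>2)"
    by (simp add: algebra_simps)
  also have "\<dots> = B * C * (B + 2 * C + (real m - 5) * D) * (y u)\<^sup>2
      + (1 + 2 * C) * C * (y b)\<^sup>2 + (1 + B) * B * ((y c)\<^sup>2 + (y d)\<^sup>2)"
    by (simp only: center deg3 deg2)
  finally have "B * C * (rho * N - F) = M + B * C * (\<Sum>j\<in>R. rho * (y j - D * y u)\<^sup>2)"
    unfolding S N' F' M_def by (simp add: power2_eq_square algebra_simps)
  then have id: "rho * N - F = M / (B * C) + (\<Sum>j\<in>R. rho * (y j - D * y u)\<^sup>2)"
    using pos by (simp add: field_simps)
  have M0: "M \<ge> 0" unfolding M_def using pos by simp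
  have S0: "(\<Sum>j\<in>R. rho * (y j - D * y u)\<^sup>2) \<ge> 0" using rho by (intro sum_nonneg) simp
  have Q0: "M / (B * C) \<ge> 0" using M0 pos by simp
  show "F \<le> rho * N" using id Q0 S0 by linarith
  assume eq: "F = rho * N"
  then have "M / (B * C) = 0" and Sz: "(\<Sum>j\<in>R. rho * (y j - D * y u)\<^sup>2) = 0"
    using id Q0 S0 by linarith+
  then have "M = 0" using pos by simp
  moreover have "C * (y b - B * y u)\<^sup>2 \<ge> 0" "B * (y c - C * y u)\<^sup>2 \<ge> 0" "B * (y d - C * y u)\<^sup>2 \<ge> 0"
    "(C * y b - B * y c)\<^sup>2 \<ge> 0" "(C * y b - B * y d)\<^sup>2 \<ge> 0"
    using pos by simp_all
  ultimately have "C * (y b - B * y u)\<^sup>2 = 0" "B * (y c - C * y u)\<^sup>2 = 0" "B * (y d - C * y u)\<^sup>2 = 0"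
    unfolding M_def by linarith+
  then have "y b = B * y u" "y c = C * y u" "y d = C * y u" using pos by auto
  moreover have "y j = D * y u" if "j \<in> R" for j
  proof -
    have "rho * (y j - D * y u)\<^sup>2 = 0"
      using Sz that R(1) rho by (subst (asm) sum_nonneg_eq_0_iff) auto
    then show ?thesis using rho by auto
  qed
  ultimately show "y b = B * y u \<and> y c = C * y u \<and> y d = C * y u \<and>
           (\<forall>j\<in>V - {u, b, c, d}. y j = D * y u)"
    by (auto simp: R_def)
qed

end

text \<open>A breadth-first tree from \<open>u\<close> contains all edges at \<open>u\<close>, so the two edges outside it avoid
  \<open>u\<close>. An arbitrary spanning tree would not do.\<close>

lemma (in extremal_weights) bicyclic_form:
  assumes H: "simple_graph H" and con: "connected_hypergraph H"
    and cV: "card (verts H) = m - 1" and cE: "card (edges H) = m" and y0: "\<And>v. 0 \<le> y v"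
  shows "2 * (\<Sum>e\<in>edges H. prod y e) \<le> rho * (\<Sum>v\<in>verts H. (y v)\<^sup>2)" (is ?le)
    and "2 * (\<Sum>e\<in>edges H. prod y e) = rho * (\<Sum>v\<in>verts H. (y v)\<^sup>2) \<Longrightarrow>
      \<exists>v\<in>verts H. y v \<noteq> 0 \<Longrightarrow>
      \<exists>u s t r. distinct [u, s, t, r] \<and> {u, s, t, r} \<subseteq> verts H \<and>
        edges H = (\<lambda>j. {u, j}) ` (verts H - {u}) \<union> {{s, t}, {s, r}}"
proof -
  note H' = simple_graphD[OF H]
  let ?V = "verts H" and ?E = "edges H"
  have ne: "?V - S \<noteq> {}" if "finite S" "card S < m - 1" for S
    using that cV by (metis Diff_eq_empty_iff card_mono leD)
  \<comment> \<open>The vertices \<open>u, b, c, d\<close> carry the four largest values of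
    \<open>y\<close> in decreasing order, with ties broken arbitrarily.\<close>
  obtain u where u: "u \<in> ?V" and umax: "\<And>v. v \<in> ?V \<Longrightarrow> y v \<le> y u"
    using finite_argmax[of ?V y] H'(1) ne[of "{}"] m by auto
  obtain b where b: "b \<in> ?V - {u}" and bmax: "\<And>v. v \<in> ?V - {u} \<Longrightarrow> y v \<le> y b"
    using finite_argmax[of "?V - {u}" y] H'(1) ne[of "{u}"] m by auto
  obtain c where c: "c \<in> ?V - {u, b}" and cmax: "\<And>v. v \<in> ?V - {u, b} \<Longrightarrow> y v \<le> y c"
  proof (rule finite_argmax[of "?V - {u, b}" y])
    show "?V - {u, b} \<noteq> {}" using m b by (intro ne) auto
  qed (use H'(1) in auto)
  obtain d where d: "d \<in> ?V - {u, b, c}" and dmax: "\<And>v. v \<in> ?V - {u, b, c} \<Longrightarrow> y v \<le> y d"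
  proof (rule finite_argmax[of "?V - {u, b, c}" y])
    show "?V - {u, b, c} \<noteq> {}" using m b c by (intro ne) auto
  qed (use H'(1) in auto)
  have sub: "{u, b, c, d} \<subseteq> ?V" and dist: "distinct [u, b, c, d]" using u b c d by auto
  obtain p where p: "\<And>j. j \<in> ?V - {u} \<Longrightarrow> {j, p j} \<in> ?E \<and> p j \<noteq> j"
    and pinj: "inj_on (\<lambda>j. {j, p j}) (?V - {u})"
    and pu: "\<And>j. {u, j} \<in> ?E \<Longrightarrow> j \<noteq> u \<Longrightarrow> p j = u"
    using bfs_parent[OF H con u] by blast
  define T where "T = (\<lambda>j. {j, p j}) ` (?V - {u})"
  have TE: "T \<subseteq> ?E" using p by (auto simp: T_def)
  have cT: "card T = m - 2"
    unfolding T_def using card_image[OF pinj] cV u H'(1) by simp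
  have finT: "finite T" using TE H'(2) finite_subset by blast
  \<comment> \<open>The tree has one edge for each of the \<open>m - 2\<close> vertices other than
    \<open>u\<close>.\<close>
  have "card (?E - T) = 2"
    using card_Diff_subset[OF finT TE] cE cT m by simp
  then obtain e1 e2 where e12: "?E - T = {e1, e2}" "e1 \<noteq> e2" by (auto simp: card_2_iff)
  have avoid: "u \<notin> e" if e: "e \<in> ?E - T" for e
  proof
    assume "u \<in> e"
    moreover have "card e = 2" using e H'(3) by blast
    ultimately obtain j where j: "e = {u, j}" "j \<noteq> u" by (auto simp: card_2_iff)
    then have "p j = u" "j \<in> ?V - {u}" using pu e H'(3)[of e] by auto
    then have "e \<in> T" using j by (auto simp: T_def insert_commute)
    then show False using e by simp
  qed
  have pV: "p j \<in> ?V" if "j \<in> ?V - {u}" for j using p[OF that] H'(3) by blast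
  have pairs: "\<exists>v w. e = {v, w} \<and> v \<noteq> w \<and> v \<in> ?V - {u} \<and> w \<in> ?V - {u} \<and> prod y e = y v * y w"
    if "e \<in> ?E - T" for e
  proof -
    have "card e = 2" "e \<subseteq> ?V" using that H'(3) by blast+
    then obtain v w where "e = {v, w}" "v \<noteq> w" by (auto simp: card_2_iff)
    then show ?thesis using avoid[OF that] \<open>e \<subseteq> ?V\<close> by auto
  qed
  have bd: "y d \<le> y c" "y c \<le> y b" using cmax bmax c d by auto
  have bound1: "prod y e \<le> y b * y c" if e: "e \<in> ?E - T" for e
  proof -
    obtain v w where vw: "v \<noteq> w" "v \<in> ?V - {u}" "w \<in> ?V - {u}" and pr: "prod y e = y v * y w"
      using pairs[OF e] by blast
    show ?thesis
    proof (cases "v = b")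
      case True
      then show ?thesis using vw pr y0 cmax[of w] by (auto intro!: mult_left_mono)
    next
      case False
      then have "y v * y w \<le> y c * y b" using vw y0 cmax[of v] bmax[of w] by (intro mult_mono) auto
      then show ?thesis using pr by (simp add: mult.commute)
    qed
  qed
  \<comment> \<open>A pair avoiding \<open>u\<close> and different from \<open>{b, c}\<close> has an
    end outside \<open>{u, b, c}\<close>, whose value is at most \<open>y d\<close>.\<close>
  have bound2: "prod y e \<le> y b * y d" if e: "e \<in> ?E - T" and bc: "e \<noteq> {b, c}" for e
  proof -
    obtain v w where vw: "v \<noteq> w" "v \<in> ?V - {u}" "w \<in> ?V - {u}" "e = {v, w}" and pr: "prod y e = y v * y w"
      using pairs[OF e] by blast
    have "v \<in> ?V - {u, b, c} \<or> w \<in> ?V - {u, b, c}" using vw bc by auto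
    then show ?thesis
    proof
      assume "v \<in> ?V - {u, b, c}"
      then have "y v * y w \<le> y d * y b" using vw y0 dmax[of v] bmax[of w] by (intro mult_mono) auto
      then show ?thesis using pr by (simp add: mult.commute)
    next
      assume "w \<in> ?V - {u, b, c}"
      then have "y v * y w \<le> y b * y d" using vw y0 dmax[of w] bmax[of v] by (intro mult_mono) auto
      then show ?thesis using pr by simp
    qed
  qed
  \<comment> \<open>At most one of the two distinct edges is \<open>{b, c}\<close>; the other one
    satisfies the sharper bound.\<close>
  have extra: "prod y e1 + prod y e2 \<le> y b * y c + y b * y d"
  proof (cases "e1 = {b, c}")
    case True
    then show ?thesis using bound1[of e1] bound2[of e2] e12 by auto
  next
    case False
    then show ?thesis using bound2[of e1] bound1[of e2] e12 by auto
  qed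
  have "(\<Sum>e\<in>?E. prod y e) = (\<Sum>e\<in>T. prod y e) + (\<Sum>e\<in>?E - T. prod y e)"
    using sum.subset_diff[OF TE H'(2), of "prod y"] by simp
  also have "(\<Sum>e\<in>?E - T. prod y e) = prod y e1 + prod y e2" using e12 by simp
  also have "(\<Sum>e\<in>T. prod y e) = (\<Sum>j\<in>?V - {u}. y j * y (p j))"
    unfolding T_def sum.reindex[OF pinj]
  proof (rule sum.cong[OF refl])
    fix j assume "j \<in> ?V - {u}"
    then have "j \<noteq> p j" using p by metis
    then show "(prod y \<circ> (\<lambda>j. {j, p j})) j = y j * y (p j)" by simp
  qed
  finally have total: "(\<Sum>e\<in>?E. prod y e) = (\<Sum>j\<in>?V - {u}. y j * y (p j)) + (prod y e1 + prod y e2)" .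
  have tree1: "y j * y (p j) \<le> y u * y j" if "j \<in> ?V - {u}" for j
    using umax[OF pV[OF that]] y0[of j] by (metis mult.commute mult_left_mono)
  then have tree: "(\<Sum>j\<in>?V - {u}. y j * y (p j)) \<le> (\<Sum>j\<in>?V - {u}. y u * y j)" by (rule sum_mono)
  define F where "F = 2 * ((\<Sum>j\<in>?V - {u}. y u * y j) + y b * y c + y b * y d)"
  note form = extremal_form[OF H'(1) cV sub dist F_def refl]
  have upper: "2 * (\<Sum>e\<in>?E. prod y e) \<le> F" unfolding total F_def using tree extra by simp
  then show ?le using form(1) by simp
  assume eq: "2 * (\<Sum>e\<in>?E. prod y e) = rho * (\<Sum>v\<in>?V. (y v)\<^sup>2)" and nz: "\<exists>v\<in>?V. y v \<noteq> 0"
  have FN: "F = rho * (\<Sum>v\<in>?V. (y v)\<^sup>2)" using upper form(1) eq by linarith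
  note vals = form(2)[OF FN]
  have yu: "y u > 0" using nz umax y0 by (metis antisym not_less order_trans)
  have "B * y u < y u" using B_less_1 yu by simp
  then have lt: "y j < y u" if "j \<in> ?V - {u}" for j using bmax[OF that] vals by simp
  have ypos: "y j > 0" if "j \<in> ?V" for j
    using that vals yu pos by (cases "j \<in> {u, b, c, d}") auto
  have "2 * (\<Sum>e\<in>?E. prod y e) = F" using eq FN by simp
  then have "(\<Sum>j\<in>?V - {u}. y j * y (p j)) + (prod y e1 + prod y e2) =
      (\<Sum>j\<in>?V - {u}. y u * y j) + (y b * y c + y b * y d)"
    unfolding total F_def by simp
  \<comment> \<open>The tree part and the extra part are each bounded separately, so equality of the
    totals forces equality in both.\<close>
  note split = this
  have sums: "(\<Sum>j\<in>?V - {u}. y j * y (p j)) = (\<Sum>j\<in>?V - {u}. y u * y j)"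
    by (rule antisym[OF tree]) (use split extra in linarith)
  have ex: "prod y e1 + prod y e2 = y b * y c + y b * y d"
    by (rule antisym[OF extra]) (use split tree in linarith)
  \<comment> \<open>Equality holds term by term. As \<open>y j > 0\<close>, the parent of
    \<open>j\<close> has the maximal value, which only \<open>u\<close> has by \<open>lt\<close>;
    the tree is a star.\<close>
  have root: "p j = u" if j: "j \<in> ?V - {u}" for j
  proof -
    have "(\<Sum>j\<in>?V - {u}. y u * y j - y j * y (p j)) = 0" using sums by (simp add: sum_subtractf)
    then have "y u * y j - y j * y (p j) = 0"
      using tree1 j H'(1) by (subst (asm) sum_nonneg_eq_0_iff) auto
    then have "y (p j) = y u" using ypos[of j] j by (auto simp: mult.commute)
    then show ?thesis using lt[of "p j"] pV[OF j] by auto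
  qed
  have T: "T = (\<lambda>j. {u, j}) ` (?V - {u})"
    unfolding T_def by (intro image_cong) (use root in auto)
  have small: "prod y e < y b * y c" if e: "e \<in> ?E - T" "b \<notin> e" for e
  proof -
    obtain v w where vw: "v \<noteq> w" "v \<in> ?V - {u}" "w \<in> ?V - {u}" "e = {v, w}" and pr: "prod y e = y v * y w"
      using pairs[OF e(1)] by blast
    have "prod y e \<le> y c * y c"
      unfolding pr using vw e(2) y0 cmax by (intro mult_mono) auto
    also have "\<dots> < y b * y c"
      using vals C_less_B yu pos by simp
    finally show ?thesis .
  qed
  have bdc: "y d = y c" using vals by simp
  have e1: "e1 \<in> ?E - T" and e2: "e2 \<in> ?E - T" using e12 by auto
  \<comment> \<open>Since \<open>y d = y c\<close>, both extra edges must reach the bound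
    \<open>y b * y c\<close>, which by \<open>small\<close> an edge missing \<open>b\<close> cannot
    do.\<close>
  have ex': "prod y e1 + prod y e2 = y b * y c + y b * y c" using ex bdc by simp
  have b1: "b \<in> e1"
  proof (rule ccontr)
    assume "b \<notin> e1"
    then show False using small[OF e1] bound1[OF e2] ex' by linarith
  qed
  have b2: "b \<in> e2"
  proof (rule ccontr)
    assume "b \<notin> e2"
    then show False using small[OF e2] bound1[OF e1] ex' by linarith
  qed
  have other: "\<exists>t. e = {b, t} \<and> t \<noteq> b \<and> t \<in> ?V - {u}" if e: "e \<in> ?E - T" "b \<in> e" for e
  proof -
    obtain v w where vw: "e = {v, w}" "v \<noteq> w" "v \<in> ?V - {u}" "w \<in> ?V - {u}"
      using pairs[OF e(1)] by blast
    show ?thesis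
    proof (cases "b = v")
      case True
      then show ?thesis using vw by (intro exI[of _ w]) simp
    next
      case False
      then have "b = w" using vw e by simp
      then show ?thesis using vw by (intro exI[of _ v]) (simp add: insert_commute)
    qed
  qed
  \<comment> \<open>The ends \<open>t\<close> and \<open>r\<close> are whatever vertices the two
    edges supply; the conclusion concerns only the shape of the graph.\<close>
  obtain t where t: "e1 = {b, t}" "t \<noteq> b" "t \<in> ?V - {u}" using other[OF e1 b1] by blast
  obtain r where r: "e2 = {b, r}" "r \<noteq> b" "r \<in> ?V - {u}" using other[OF e2 b2] by blast
  have "t \<noteq> r" using e12 t r by auto
  have "?E = T \<union> {e1, e2}" using TE e12 by blast
  then have "?E = (\<lambda>j. {u, j}) ` (?V - {u}) \<union> {{b, t}, {b, r}}" using T t r by simp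
  moreover have "distinct [u, b, t, r]" "{u, b, t, r} \<subseteq> ?V" using t r b u \<open>t \<noteq> r\<close> by auto
  ultimately show "\<exists>u s t r. distinct [u, s, t, r] \<and> {u, s, t, r} \<subseteq> verts H \<and>
        edges H = (\<lambda>j. {u, j}) ` (verts H - {u}) \<union> {{s, t}, {s, r}}" by blast
qed

text \<open>A strict inequality at each vector does not by itself bound a supremum away from
  \<open>rho\<close>. Both sides are homogeneous of degree 2, so it suffices to look at nonnegative
  unit vectors, where compactness gives a maximiser; \<open>mu\<close> is its value.\<close>

lemma edge_form_strict_gap:
  assumes H: "simple_graph H" and ne: "verts H \<noteq> {}"
    and strict: "\<And>y. (\<And>v. 0 \<le> y v) \<Longrightarrow> \<exists>v\<in>verts H. y v \<noteq> 0 \<Longrightarrow>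
        2 * (\<Sum>e\<in>edges H. prod y e) < rho * (\<Sum>v\<in>verts H. (y v)\<^sup>2)"
  obtains mu :: real where "0 \<le> mu" "mu < rho"
    "\<And>y. (\<forall>v. 0 \<le> y v) \<Longrightarrow> 2 * (\<Sum>e\<in>edges H. prod y e) \<le> mu * (\<Sum>v\<in>verts H. (y v)\<^sup>2)"
proof -
  note H' = simple_graphD[OF H]
  let ?V = "verts H" and ?E = "edges H"
  define Q :: "('a \<Rightarrow> real) \<Rightarrow> real" where "Q y = 2 * (\<Sum>e\<in>?E. prod y e)" for y
  define N :: "('a \<Rightarrow> real) \<Rightarrow> real" where "N y = (\<Sum>v\<in>?V. (y v)\<^sup>2)" for y
  have cQ: "continuous_on UNIV Q"
    unfolding Q_def by (intro continuous_intros continuous_on_product_coordinates)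
  have cN: "continuous_on UNIV N"
    unfolding N_def by (intro continuous_intros continuous_on_product_coordinates)
  \<comment> \<open>Coordinates outside the vertex set are pinned to 0. A product of compact sets is
    then compact in the topology of functions.\<close>
  define P where "P = PiE UNIV (\<lambda>v. if v \<in> ?V then {0..1::real} else {0})"
  have "compactin (product_topology (\<lambda>_. euclidean) UNIV) P"
    unfolding P_def by (subst compactin_PiE) auto
  then have "compact P" by (simp add: euclidean_product_topology)
  moreover have "closed {y. N y = 1}" by (intro closed_Collect_eq cN continuous_on_const)
  ultimately have cK: "compact (P \<inter> {y. N y = 1})" by (rule compact_Int_closed)
  have scale: "\<exists>z \<in> P \<inter> {y. N y = 1}. Q y = Q z * N y" if y: "\<forall>v. 0 \<le> y v" and pos: "N y > 0" for y
  proof -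
    define z where "z = (\<lambda>v. if v \<in> ?V then y v / sqrt (N y) else 0)"
    have "N z = (\<Sum>v\<in>?V. (y v)\<^sup>2 / N y)"
      unfolding N_def[of z] by (intro sum.cong) (use pos in \<open>auto simp: z_def power_divide\<close>)
    also have "\<dots> = 1" using pos by (simp add: sum_divide_distrib[symmetric] N_def)
    finally have Nz: "N z = 1" .
    have "z v \<le> 1" if v: "v \<in> ?V" for v
    proof -
      have "(z v)\<^sup>2 \<le> N z" unfolding N_def using v H'(1) by (intro member_le_sum) auto
      then have "(z v)\<^sup>2 \<le> 1\<^sup>2" using Nz by simp
      then show ?thesis by (rule power2_le_imp_le) simp
    qed
    moreover have "0 \<le> z v" for v using y pos by (simp add: z_def)
    ultimately have "z \<in> P" by (auto simp: P_def) (simp add: z_def)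
    have "prod z e = prod y e / N y" if e: "e \<in> ?E" for e
    proof -
      have "prod z e = (\<Prod>v\<in>e. y v / sqrt (N y))"
        by (intro prod.cong) (use H'(3)[OF e] in \<open>auto simp: z_def\<close>)
      also have "\<dots> = prod y e / N y"
        using H'(3)[OF e] pos by (simp add: prod_dividef)
      finally show ?thesis .
    qed
    then have "Q z = Q y / N y" unfolding Q_def by (simp flip: sum_divide_distrib)
    then show ?thesis using \<open>z \<in> P\<close> Nz pos by (intro bexI[of _ z]) auto
  qed
  have "N (\<lambda>_. 1) > 0" unfolding N_def using H'(1) ne by (simp add: card_gt_0_iff)
  then have "P \<inter> {y. N y = 1} \<noteq> {}" using scale[of "\<lambda>_. 1"] by auto
  then obtain z where z: "z \<in> P" "N z = 1" and zmax: "\<And>x. x \<in> P \<inter> {y. N y = 1} \<Longrightarrow> Q x \<le> Q z"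
    using continuous_attains_sup[OF cK _ continuous_on_subset[OF cQ]] by blast
  have znn: "0 \<le> z v" for v
  proof -
    have "z v \<in> (if v \<in> ?V then {0..1} else {0})" using z(1) unfolding P_def by (rule PiE_mem) simp
    then show ?thesis by (simp split: if_splits)
  qed
  have "\<exists>v\<in>?V. z v \<noteq> 0" using z(2) unfolding N_def by (rule_tac ccontr) simp
  then have "Q z < rho * N z" unfolding Q_def N_def using znn by (intro strict)
  then have "Q z < rho" using z by simp
  moreover have "0 \<le> Q z" unfolding Q_def using znn by (simp add: sum_nonneg prod_nonneg)
  \<comment> \<open>A vector of norm zero vanishes on all vertices and so does its form; any other
    is rescaled into the compact set.\<close>
  moreover have "Q y \<le> Q z * N y" if y: "\<forall>v. 0 \<le> y v" for y
  proof (cases "N y = 0")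
    case True
    then have "y v = 0" if "v \<in> ?V" for v
      using that H'(1) by (simp add: N_def sum_nonneg_eq_0_iff)
    have "prod y e = 0" if e: "e \<in> ?E" for e
    proof -
      obtain v where "v \<in> e" using H'(3)[OF e] by fastforce
      then show ?thesis using H'(3)[OF e] \<open>\<And>v. v \<in> ?V \<Longrightarrow> y v = 0\<close> by (meson prod_zero subsetD)
    qed
    then have "Q y = 0" by (simp add: Q_def)
    then show ?thesis using True by simp
  next
    case False
    moreover have "N y \<ge> 0" by (simp add: N_def sum_nonneg)
    ultimately have pos: "N y > 0" by simp
    then obtain x where "x \<in> P \<inter> {y. N y = 1}" "Q y = Q x * N y" using scale[OF y] by blast
    then show ?thesis using zmax pos by (simp add: mult_right_mono)
  qed
  ultimately show ?thesis using that[of "Q z"] unfolding Q_def N_def by blast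
qed

section \<open>The extremal graph\<close>

lemma verts_H_graph:
  assumes "m > 5"
  shows "verts (H_graph m) = {0..<m - 1}"
proof -
  have "verts (H_graph m) = {0, 1, 2, 3} \<union> {4..<m - 1}"
    by (simp add: H_graph_def K4_minus_edge_def)
  also have "\<dots> = {0..<m - 1}" using assms by auto
  finally show ?thesis .
qed

lemma edges_K4_minus_edge: "edges K4_minus_edge = {{0, 1}, {0, 2}, {0, 3}, {1, 2}, {1, 3}}"
proof (intro equalityI subsetI)
  fix e assume "e \<in> edges K4_minus_edge"
  then have "e \<subseteq> {0, 1, 2, 3}" "card e = 2" "e \<noteq> {2, 3}" by (auto simp: K4_minus_edge_def)
  then show "e \<in> {{0, 1}, {0, 2}, {0, 3}, {1, 2}, {1, 3}}"
  proof -
    obtain x y where "e = {x, y}" "x \<noteq> y" using \<open>card e = 2\<close> by (auto simp: card_2_iff)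
    moreover from this have "x \<in> {0, 1, 2, 3}" "y \<in> {0, 1, 2, 3}" using \<open>e \<subseteq> _\<close> by auto
    ultimately show ?thesis using \<open>e \<noteq> _\<close> by (auto simp: doubleton_eq_iff)
  qed
next
  fix e :: "nat set" assume e: "e \<in> {{0, 1}, {0, 2}, {0, 3}, {1, 2}, {1, 3}}"
  then have "0 \<in> e \<or> 1 \<in> e" by blast
  then have "e \<noteq> {2, 3}" by auto
  moreover have "e \<subseteq> {0, 1, 2, 3}" using e by blast
  moreover have "card e = 2" using e by fastforce
  ultimately show "e \<in> edges K4_minus_edge" by (simp add: K4_minus_edge_def)
qed

text \<open>A full star at \<open>0\<close> plus two edges at \<open>1\<close>: the shape that the
  equality case of \<open>bicyclic_form\<close> delivers.\<close>

lemma edges_H_graph: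
  assumes "m > 5"
  shows "edges (H_graph m) = (\<lambda>j. {0, j}) ` {1..<m - 1} \<union> {{1, 2}, {1, 3}}"
proof -
  have "{1..<m - 1} = {1, 2, 3} \<union> {4..<m - 1}" using assms by auto
  then have "(\<lambda>j. {0, j}) ` {1..<m - 1} =
      {{0, 1}, {0, 2}, {0, 3}} \<union> (\<lambda>j. {0, j}) ` {4..<m - 1}" by (simp only: image_Un) simp
  moreover have "edges (H_graph m) = {{0, 1}, {0, 2}, {0, 3}, {1, 2}, {1, 3}} \<union> (\<lambda>j. {0, j}) ` {4..<m - 1}"
    unfolding edges_K4_minus_edge[symmetric] by (simp add: H_graph_def)
  ultimately show ?thesis by auto
qed

lemma simple_H_graph:
  assumes "m > 5"
  shows "simple_graph (H_graph m)"
proof -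
  have "e \<subseteq> {0..<m - 1} \<and> card e = 2" if "e \<in> edges (H_graph m)" for e
    using that assms unfolding edges_H_graph[OF assms] by auto
  then show ?thesis by (auto simp: uniform_hypergraph_def verts_H_graph[OF assms])
qed

lemma card_edges_H_graph:
  assumes "m > 5"
  shows "card (edges (H_graph m)) = m"
proof -
  have "inj_on (\<lambda>j. {0, j}) {1..<m - 1}" by (rule inj_onI) (auto simp: doubleton_eq_iff)
  then have "card ((\<lambda>j. {0, j}) ` {1..<m - 1}) = m - 2" by (simp add: card_image)
  moreover have "card {{1, 2}, {1, 3::nat}} = 2" by (simp add: doubleton_eq_iff)
  moreover have "card (edges (H_graph m)) = card ((\<lambda>j. {0, j}) ` {1..<m - 1}) + card {{1, 2}, {1, 3::nat}}"
    unfolding edges_H_graph[OF assms]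
  proof (rule card_Un_disjoint)
    have "0 \<notin> e" if "e \<in> {{1, 2}, {1, 3::nat}}" for e using that by auto
    then show "(\<lambda>j. {0, j}) ` {1..<m - 1} \<inter> {{1, 2}, {1, 3}} = {}" by blast
  qed auto
  ultimately show ?thesis using assms by simp
qed

lemma connected_H_graph:
  assumes "m > 5"
  shows "connected_hypergraph (H_graph m)"
proof -
  have a: "(0, v) \<in> adj (H_graph m)" if "v \<in> verts (H_graph m)" for v
  proof (cases "v = 0")
    case True
    then show ?thesis using assms unfolding adj_def edges_H_graph[OF assms]
      by (auto intro!: bexI[of _ "{0, 1}"])
  next
    case False
    then show ?thesis using assms that unfolding adj_def edges_H_graph[OF assms]
      by (auto simp: verts_H_graph intro!: bexI[of _ "{0, v}"])
  qed
  show ?thesis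
    unfolding connected_iff_adj[OF simple_H_graph[OF assms]]
    using a adj_sym by (metis converse_rtrancl_into_rtrancl r_into_rtrancl)
qed

text \<open>The four named vertices go to \<open>0, 1, 2, 3\<close>. The remaining
  \<open>m - 5\<close> vertices hang only on \<open>u\<close> and are interchangeable, so any
  bijection \<open>g\<close> onto the leaves will do.\<close>

lemma iso_H_graph:
  assumes H: "simple_graph H" and m: "m > 5" and cV: "card (verts H) = m - 1"
    and dist: "distinct [u, s, t, r]" and sub: "{u, s, t, r} \<subseteq> verts H"
    and E: "edges H = (\<lambda>j. {u, j}) ` (verts H - {u}) \<union> {{s, t}, {s, r}}"
  shows "hypergraph_iso H (H_graph m)"
proof -
  let ?R = "verts H - {u, s, t, r}"
  have fin: "finite (verts H)" using simple_graphD(1)[OF H] .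
  have "card ?R = m - 5"
    using fin sub dist cV by (subst card_Diff_subset) auto
  then obtain g where g: "bij_betw g ?R {4..<m - 1}"
    using finite_same_card_bij[of ?R "{4..<m - 1}"] fin by auto
  define f where "f v = (if v = u then 0 else if v = s then 1 else if v = t then 2
      else if v = r then 3 else g v)" for v
  have f: "f u = 0" "f s = 1" "f t = 2" "f r = 3" using dist by (auto simp: f_def)
  have "bij_betw f ?R {4..<m - 1}"
    using g by (subst bij_betw_cong[of _ _ g]) (auto simp: f_def)
  moreover have "bij_betw f {u, s, t, r} {0, 1, 2, 3}"
    using f by (auto simp: bij_betw_def)
  ultimately have "bij_betw f ({u, s, t, r} \<union> ?R) ({0, 1, 2, 3} \<union> {4..<m - 1})"
    by (intro bij_betw_combine) auto
  moreover have "{u, s, t, r} \<union> ?R = verts H" using sub by auto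
  moreover have "{0, 1, 2, 3} \<union> {4..<m - 1} = verts (H_graph m)" using m by (auto simp: verts_H_graph)
  ultimately have bij: "bij_betw f (verts H) (verts (H_graph m))" by simp
  then have "f ` (verts H - {u}) = {0..<m - 1} - {0}"
    using sub f m unfolding bij_betw_def
    by (subst inj_on_image_set_diff[of f "verts H"]) (auto simp: verts_H_graph)
  also have "{0..<m - 1} - {0} = {1..<m - 1}" by auto
  finally have img: "f ` (verts H - {u}) = {1..<m - 1}" .
  have "(\<lambda>e. f ` e) ` edges H = (\<lambda>j. {0, f j}) ` (verts H - {u}) \<union> {{1, 2}, {1, 3}}"
    unfolding E image_Un image_image by (simp add: f)
  also have "(\<lambda>j. {0, f j}) ` (verts H - {u}) = (\<lambda>j. {0, j}) ` {1..<m - 1}"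
    unfolding img[symmetric] image_image ..
  finally show ?thesis
    unfolding hypergraph_iso_def edges_H_graph[OF m] using bij by blast
qed

section \<open>The Perron vector of the extremal graph\<close>

text \<open>Solving \<open>leaf\<close>, \<open>deg3\<close> and \<open>deg2\<close> expresses
  \<open>D\<close>, \<open>B\<close> and \<open>C\<close> through \<open>rho\<close>, with
  denominators \<open>rho\<close> and \<open>rho\<^sup>2 - 2\<close>. Substitution into
  \<open>center\<close> and clearing denominators gives the quartic \<open>f\<close>, and the
  intermediate value theorem supplies a root above 2.\<close>

lemma extremal_weights_exist:
  assumes m: "m > 5"
  obtains rho B C D where "extremal_weights m rho B C D"
proof -
  define f :: "real \<Rightarrow> real" where "f r = r ^ 4 - real m * r\<^sup>2 - 4 * r + 2 * (real m - 5)" for r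
  have m': "real m \<ge> 6" using m by simp
  have "f 2 < 0" using m' by (simp add: f_def)
  \<comment> \<open>Here \<open>f (real m)\<close> is \<open>m ^ 3 * (m - 1) - 2 * m - 10\<close>,
    which is at least \<open>36 * m - 2 * m - 10\<close> for \<open>m\<close> at least 6.\<close>
  have "f (real m) \<ge> 0"
  proof -
    have "real m ^ 3 * 1 \<le> real m ^ 3 * (real m - 1)" using m' by (intro mult_left_mono) auto
    moreover have "real m * 36 \<le> real m * (real m)\<^sup>2"
      using m' power_mono[of 6 "real m" 2] by (intro mult_left_mono) auto
    moreover have "f (real m) = real m ^ 3 * (real m - 1) - 2 * real m - 10"
      "real m ^ 3 = real m * (real m)\<^sup>2"
      by (simp_all add: f_def power2_eq_square power3_eq_cube power4_eq_xxxx algebra_simps)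
    ultimately show ?thesis using m' by linarith
  qed
  moreover have "continuous_on {2..real m} f" unfolding f_def by (intro continuous_intros)
  ultimately obtain r where r: "2 \<le> r" "r \<le> real m" "f r = 0"
    using IVT'[of f 2 0 "real m"] \<open>f 2 < 0\<close> m' by force
  have r2: "r > 2" using r \<open>f 2 < 0\<close> by (cases "r = 2") auto
  have "r\<^sup>2 > 2 * 2" unfolding power2_eq_square using r2 by (intro mult_strict_mono) auto
  then have q: "r\<^sup>2 - 2 > 0" by simp
  have "(r + 2) / (r\<^sup>2 - 2) + 2 * ((r + 1) / (r\<^sup>2 - 2)) + (real m - 5) * (1 / r) = r"
  proof -
    have "(r + 2) / (r\<^sup>2 - 2) + 2 * ((r + 1) / (r\<^sup>2 - 2)) + (real m - 5) * (1 / r)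
       = ((3 * r + 4) * r + (real m - 5) * (r\<^sup>2 - 2)) / ((r\<^sup>2 - 2) * r)"
    proof -
      have "(r + 2) / q + 2 * ((r + 1) / q) + (real m - 5) * (1 / r)
        = ((3 * r + 4) * r + (real m - 5) * q) / (q * r)" if "q \<noteq> 0" for q
        using that r2 by (simp add: field_simps)
      then show ?thesis using q by simp
    qed
    also have "(3 * r + 4) * r + (real m - 5) * (r\<^sup>2 - 2) = r * ((r\<^sup>2 - 2) * r)"
      using r(3) unfolding f_def by (simp add: power2_eq_square power4_eq_xxxx algebra_simps)
    finally show ?thesis using q r2 by simp
  qed
  moreover have "1 + 2 * ((r + 1) / (r\<^sup>2 - 2)) = r * ((r + 2) / (r\<^sup>2 - 2))"
    "1 + (r + 2) / (r\<^sup>2 - 2) = r * ((r + 1) / (r\<^sup>2 - 2))"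
    using q by (simp_all add: field_simps power2_eq_square)
  ultimately have "extremal_weights m r ((r + 2) / (r\<^sup>2 - 2)) ((r + 1) / (r\<^sup>2 - 2)) (1 / r)"
    using m r2 q by unfold_locales auto
  then show ?thesis using that by blast
qed

text \<open>Numbers beyond the vertex set also receive \<open>D\<close>, so the function is positive
  everywhere, as \<open>eigenvalue_power_of_eigenvector\<close> asks.\<close>

definition (in extremal_weights) perron :: "nat \<Rightarrow> real" where
  "perron v = (if v = 0 then 1 else if v = 1 then B else if v < 4 then C else D)"

lemma (in extremal_weights) perron_eigenvector:
  assumes v: "v \<in> verts (H_graph m)"
  shows "(\<Sum>e\<in>{e \<in> edges (H_graph m). v \<in> e}. prod perron (e - {v})) = rho * perron v"
proof -
  have vm: "v < m - 1" using v verts_H_graph[OF m] by simp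
  note E = edges_H_graph[OF m]
  \<comment> \<open>Every vertex except the center lies on exactly one star edge; only the two edges
    at \<open>1\<close> can come in addition.\<close>
  have E': "{e \<in> edges (H_graph m). v \<in> e} = insert {0, v} {e \<in> {{1, 2}, {1, 3}}. v \<in> e}" if "v \<noteq> 0"
    unfolding E using that vm by auto
  consider "v = 0" | "v = 1" | "v = 2" | "v = 3" | "v \<ge> 4" by linarith
  then show ?thesis
  proof cases
    case 1
    have "{e \<in> edges (H_graph m). v \<in> e} = (\<lambda>j. {0, j}) ` {1..<m - 1}"
      unfolding E 1 by auto
    moreover have "inj_on (\<lambda>j. {0, j}) {1..<m - 1}" by (rule inj_onI) (auto simp: doubleton_eq_iff)
    ultimately have "(\<Sum>e\<in>{e \<in> edges (H_graph m). v \<in> e}. prod perron (e - {v})) =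
        (\<Sum>j\<in>{1..<m - 1}. prod perron ({0, j} - {0}))"
      by (simp add: sum.reindex 1)
    also have "\<dots> = (\<Sum>j\<in>{1..<m - 1}. perron j)"
    proof (rule sum.cong[OF refl])
      fix j assume "j \<in> {1..<m - 1}"
      then have "{0, j} - {0} = {j}" by auto
      then show "prod perron ({0, j} - {0}) = perron j" by simp
    qed
    also have "{1..<m - 1} = {1, 2, 3} \<union> {4..<m - 1}" using m by auto
    also have "(\<Sum>j\<in>{1, 2, 3} \<union> {4..<m - 1}. perron j) =
        (\<Sum>j\<in>{1, 2, 3}. perron j) + (\<Sum>j\<in>{4..<m - 1}. perron j)"
      by (rule sum.union_disjoint) auto
    also have "(\<Sum>j\<in>{4..<m - 1}. perron j) = (\<Sum>j\<in>{4..<m - 1}. D)"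
      by (rule sum.cong) (auto simp: perron_def)
    also have "\<dots> = (real m - 5) * D" using m by simp
    also have "(\<Sum>j\<in>{1, 2, 3}. perron j) = B + 2 * C" by (simp add: perron_def)
    finally show ?thesis using center 1 by (simp add: perron_def)
  next
    case 2
    have "{e \<in> {{1, 2}, {1, 3}}. 1 \<in> e} = ({{1, 2}, {1, 3}} :: nat set set)" by auto
    then have "{e \<in> edges (H_graph m). v \<in> e} = {{0, 1}, {1, 2}, {1, 3}}"
      using E' unfolding 2 by simp
    moreover have "{0, 1::nat} - {1} = {0}" "{1, 2::nat} - {1} = {2}" "{1, 3::nat} - {1} = {3}" by auto
    ultimately show ?thesis using 2 deg3 by (simp add: perron_def doubleton_eq_iff)
  next
    case 3
    have "{e \<in> {{1, 2}, {1, 3}}. 2 \<in> e} = ({{1, 2}} :: nat set set)" by auto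
    then have "{e \<in> edges (H_graph m). v \<in> e} = {{0, 2}, {1, 2}}"
      using E' unfolding 3 by simp
    moreover have "{0, 2::nat} - {2} = {0}" "{1, 2::nat} - {2} = {1}" by auto
    ultimately show ?thesis using 3 deg2 by (simp add: perron_def doubleton_eq_iff)
  next
    case 4
    have "{e \<in> {{1, 2}, {1, 3}}. 3 \<in> e} = ({{1, 3}} :: nat set set)" by auto
    then have "{e \<in> edges (H_graph m). v \<in> e} = {{0, 3}, {1, 3}}"
      using E' unfolding 4 by simp
    moreover have "{0, 3::nat} - {3} = {0}" "{1, 3::nat} - {3} = {1}" by auto
    ultimately show ?thesis using 4 deg2 by (simp add: perron_def doubleton_eq_iff)
  next
    case 5
    then have "{e \<in> {{1, 2}, {1, 3}}. v \<in> e} = {}" and "v \<noteq> 0" by auto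
    then have "{e \<in> edges (H_graph m). v \<in> e} = {{0, v}}"
      using E' by metis
    moreover have "{0, v} - {v} = {0}" using 5 by auto
    ultimately show ?thesis using 5 leaf by (simp add: perron_def)
  qed
qed

section \<open>Connectedness, cyclomatic number and isomorphisms of powers\<close>

lemma rtrancl_map:
  assumes "\<And>x y. (x, y) \<in> r \<Longrightarrow> (f x, f y) \<in> s" and "(a, b) \<in> r\<^sup>*"
  shows "(f a, f b) \<in> s\<^sup>*"
  using assms(2)
proof (induction rule: rtrancl_induct)
  case (step y z)
  show ?case using step.IH assms(1)[OF step.hyps(2)] by (rule rtrancl_into_rtrancl)
qed simp

lemma connected_power_iff:
  assumes H: "simple_graph H" and k: "k \<ge> 2"
  shows "connected_hypergraph (power_of_graph H k) \<longleftrightarrow> connected_hypergraph H"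
proof
  let ?P = "power_of_graph H k"
  note U = uniform_power[OF H k]
  note H' = simple_graphD[OF H]
  {
    assume con: "connected_hypergraph ?P"
    have "(a, b) \<in> (adj H)\<^sup>*" if a: "a \<in> verts H" and b: "b \<in> verts H" for a b
    proof -
      \<comment> \<open>An invariant along paths of the power: a new vertex counts as reached once
        its edge has an end reachable from \<open>a\<close> in \<open>H\<close>. At original
        vertices it is reachability in \<open>H\<close>.\<close>
      define reached where "reached w = (case w of Inl v \<Rightarrow> (a, v) \<in> (adj H)\<^sup>*
          | Inr (e, j) \<Rightarrow> \<exists>v\<in>e. (a, v) \<in> (adj H)\<^sup>*)" for w :: "'a + 'a set \<times> nat"
      have closed: "reached w'" if w: "(w, w') \<in> adj ?P" "reached w" for w w'
      proof -
        obtain e where e: "e \<in> edges H" "w \<in> power_edge k e" "w' \<in> power_edge k e"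
          using w(1) by (auto simp: adj_def edges_power)
        obtain v where v: "v \<in> e" "(a, v) \<in> (adj H)\<^sup>*"
          using e(2) w(2) by (auto simp: reached_def power_edge_def)
        have all: "(a, v') \<in> (adj H)\<^sup>*" if "v' \<in> e" for v'
        proof -
          have "(v, v') \<in> adj H" using v that e(1) by (auto simp: adj_def)
          then show ?thesis using v(2) by (rule rtrancl_into_rtrancl[rotated])
        qed
        show ?thesis using e(3) v all by (auto simp: reached_def power_edge_def)
      qed
      have "(Inl a, Inl b) \<in> (adj ?P)\<^sup>*"
        using con a b unfolding connected_iff_adj[OF U] by (simp add: verts_power)
      then have "reached (Inl b)"
      proof (induction rule: rtrancl_induct)
        case base
        show ?case by (simp add: reached_def)
      qed (rule closed)
      then show ?thesis by (simp add: reached_def)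
    qed
    then show "connected_hypergraph H" by (simp add: connected_iff_adj[OF H])
  }
  assume con: "connected_hypergraph H"
  have base: "(Inl a, Inl b) \<in> (adj ?P)\<^sup>*" if "a \<in> verts H" "b \<in> verts H" for a b
  proof -
    have "(a, b) \<in> (adj H)\<^sup>*" using con that by (simp add: connected_iff_adj[OF H])
    moreover have "(Inl x, Inl y) \<in> adj ?P" if "(x, y) \<in> adj H" for x y
      using that by (auto simp: adj_def edges_power)
    ultimately show ?thesis using rtrancl_map[of "adj H" Inl "adj ?P" a b] by blast
  qed
  \<comment> \<open>A new vertex shares its edge with an original one, so paths between original
    vertices connect everything.\<close>
  have near: "\<exists>a\<in>verts H. (w, Inl a) \<in> (adj ?P)\<^sup>* \<and> (Inl a, w) \<in> (adj ?P)\<^sup>*" if "w \<in> verts ?P" for w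
    using that unfolding verts_power
  proof (elim UnE imageE)
    fix q assume "q \<in> edges H \<times> {1..k - 2}" "w = Inr q"
    then obtain e j where w: "e \<in> edges H" "j \<in> {1..k - 2}" "w = Inr (e, j)" by auto
    obtain v where v: "v \<in> e" using H'(3)[OF w(1)] by fastforce
    have "(w, Inl v) \<in> adj ?P" using w v by (auto simp: adj_def edges_power)
    moreover have "v \<in> verts H" using v w H'(3) by blast
    ultimately show ?thesis using adj_sym[of w "Inl v" ?P] by (meson r_into_rtrancl)
  qed auto
  show "connected_hypergraph ?P"
    unfolding connected_iff_adj[OF U] using near base by (meson rtrancl_trans)
qed

lemma connected_iso:
  assumes iso: "hypergraph_iso G G'" and G: "uniform_hypergraph k G" and G': "uniform_hypergraph k G'"
    and con: "connected_hypergraph G"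
  shows "connected_hypergraph G'"
proof -
  obtain f where f: "bij_betw f (verts G) (verts G')" and E: "(\<lambda>e. f ` e) ` edges G = edges G'"
    using iso by (auto simp: hypergraph_iso_def)
  have "(f a, f b) \<in> adj G'" if "(a, b) \<in> adj G" for a b
    using that unfolding adj_def E[symmetric] by blast
  then have "(f a, f b) \<in> (adj G')\<^sup>*" if "a \<in> verts G" "b \<in> verts G" for a b
    using con that rtrancl_map[of "adj G" f "adj G'" a b] by (simp add: connected_iff_adj[OF G])
  moreover have "verts G' = f ` verts G" using f by (simp add: bij_betw_def)
  ultimately show ?thesis by (simp add: connected_iff_adj[OF G'])
qed

lemma cyclomatic_connected:
  assumes "connected_hypergraph G" and "verts G \<noteq> {}"
  shows "cyclomatic_number k G = int (card (edges G)) * (int k - 1) - int (card (verts G)) + 1"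
proof -
  have "{(u, v). u \<in> verts G \<and> v \<in> verts G \<and> joined G u v} = verts G \<times> verts G"
    using assms by (auto simp: connected_hypergraph_def)
  then have "Defs.components G = {verts G}"
    using assms(2) by (auto simp: Defs.components_def quotient_def)
  then show ?thesis by (simp add: cyclomatic_number_def)
qed

text \<open>The \<open>k - 2\<close> new vertices per edge cancel against the factor
  \<open>k - 1\<close>, so the power has the cyclomatic number of \<open>H\<close>.\<close>

lemma cyclomatic_power:
  assumes H: "simple_graph H" and k: "k \<ge> 2" and con: "connected_hypergraph H" and ne: "verts H \<noteq> {}"
  shows "cyclomatic_number k (power_of_graph H k) = int (card (edges H)) - int (card (verts H)) + 1"
proof -
  have "verts (power_of_graph H k) \<noteq> {}" using ne by (simp add: verts_power)
  moreover obtain n where "k = 2 + n" using k le_Suc_ex by blast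
  ultimately show ?thesis
    using cyclomatic_connected[of "power_of_graph H k" k] con connected_power_iff[OF H k]
    by (simp add: card_edges_power card_verts_power[OF H] algebra_simps)
qed

lemma iso_power:
  assumes H: "simple_graph H" and iso: "hypergraph_iso H H'"
  shows "hypergraph_iso (power_of_graph H k) (power_of_graph H' k)"
proof -
  obtain f where f: "bij_betw f (verts H) (verts H')" and E: "(\<lambda>e. f ` e) ` edges H = edges H'"
    using iso by (auto simp: hypergraph_iso_def)
  have inj: "inj_on f (verts H)" and img: "f ` verts H = verts H'" using f by (auto simp: bij_betw_def)
  note injE = inj_on_edge_image[OF H inj]
  \<comment> \<open>The new vertex with index \<open>j\<close> on \<open>e\<close> goes to the one
    with the same index on the image of \<open>e\<close>.\<close>
  define F where "F = map_sum f (\<lambda>(e, j::nat). (f ` e, j))"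
  have F: "F (Inl v) = Inl (f v)" "F (Inr (e, j)) = Inr (f ` e, j)" for v e j by (auto simp: F_def)
  have edge: "F ` power_edge k e = power_edge k (f ` e)" for e
    unfolding power_edge_def image_Un by (auto simp: F image_iff)
  have "inj_on F (verts (power_of_graph H k))"
  proof (rule inj_onI)
    fix x y assume "x \<in> verts (power_of_graph H k)" "y \<in> verts (power_of_graph H k)" "F x = F y"
    then show "x = y"
      unfolding verts_power
      by (elim UnE imageE) (auto simp: F dest: inj_onD[OF inj] inj_onD[OF injE])
  qed
  moreover have "F ` verts (power_of_graph H k) = verts (power_of_graph H' k)"
  proof -
    have "F ` Inl ` verts H = Inl ` verts H'" by (auto simp: F img[symmetric] image_image)
    moreover have "F ` Inr ` (edges H \<times> {1..k - 2}) = Inr ` (edges H' \<times> {1..k - 2})"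
    proof -
      have "F ` Inr ` (edges H \<times> {1..k - 2}) = Inr ` map_prod (\<lambda>e. f ` e) id ` (edges H \<times> {1..k - 2})"
        unfolding image_image by (intro image_cong) (auto simp: F)
      also have "map_prod (\<lambda>e. f ` e) id ` (edges H \<times> {1..k - 2}) = edges H' \<times> {1..k - 2}"
        unfolding E[symmetric] by (rule map_prod_surj_on) auto
      finally show ?thesis .
    qed
    ultimately show ?thesis by (simp only: verts_power image_Un)
  qed
  moreover have "(\<lambda>e. F ` e) ` edges (power_of_graph H k) = edges (power_of_graph H' k)"
    unfolding edges_power image_image edge E[symmetric] ..
  ultimately show ?thesis unfolding hypergraph_iso_def bij_betw_def by blast
qed

text \<open>\<open>power_hypergraph\<close> asks for a base graph over the vertex type of the power
  itself, so \<open>H\<close> is replaced by its copy under \<open>Inl\<close>.\<close>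

lemma power_hypergraph_power_of_graph:
  assumes H: "simple_graph H"
  shows "power_hypergraph k (power_of_graph H k)"
proof -
  define H' :: "('a + 'a set \<times> nat) hypergraph" where
    "H' = \<lparr>verts = Inl ` verts H, edges = (\<lambda>e. Inl ` e) ` edges H\<rparr>"
  have "hypergraph_iso H H'"
    unfolding hypergraph_iso_def H'_def
    by (intro exI[of _ Inl]) (auto simp: bij_betw_def)
  moreover have "simple_graph H'"
    using simple_graphD[OF H] by (auto simp: uniform_hypergraph_def H'_def card_image)
  ultimately show ?thesis
    unfolding power_hypergraph_def using iso_power[OF H] by blast
qed

lemma bicyclic_power_hypergraph_B_P:
  assumes k: "k \<ge> 3" and m: "m > 5"
  shows "bicyclic_power_hypergraph k m (B_P k m)"
proof -
  note H = simple_H_graph[OF m]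
  have k2: "k \<ge> 2" using k by simp
  have "verts (H_graph m) \<noteq> {}" "card (verts (H_graph m)) = m - 1" using m by (auto simp: verts_H_graph)
  then have "cyclomatic_number k (power_of_graph (H_graph m) k) = 2"
    using cyclomatic_power[OF H k2 connected_H_graph[OF m]] m
    by (simp add: card_edges_H_graph)
  then show ?thesis
    unfolding bicyclic_power_hypergraph_def bicyclic_def B_P_def
    using uniform_power[OF H k2] power_hypergraph_power_of_graph[OF H]
      connected_power_iff[OF H k2] connected_H_graph[OF m]
    by (simp add: card_edges_power card_edges_H_graph[OF m])
qed

lemma bicyclic_power_hypergraphE:
  fixes G :: "'a hypergraph"
  assumes G: "bicyclic_power_hypergraph k m G" and k: "k \<ge> 3" and m: "m > 5"
  obtains H :: "'a hypergraph" where "simple_graph H" "hypergraph_iso G (power_of_graph H k)"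
    "connected_hypergraph H" "card (verts H) = m - 1" "card (edges H) = m"
proof -
  have U: "uniform_hypergraph k G" and con: "connected_hypergraph G"
    and cyc: "cyclomatic_number k G = 2" and cE: "card (edges G) = m" and k2: "k \<ge> 2"
    using G k by (simp_all add: bicyclic_power_hypergraph_def bicyclic_def)
  obtain H :: "'a hypergraph" where H: "simple_graph H" and iso: "hypergraph_iso G (power_of_graph H k)"
    using G by (auto simp: bicyclic_power_hypergraph_def power_hypergraph_def)
  note U' = uniform_power[OF H k2]
  obtain f where f: "bij_betw f (verts G) (verts (power_of_graph H k))"
    and E: "(\<lambda>e. f ` e) ` edges G = edges (power_of_graph H k)"
    using iso by (auto simp: hypergraph_iso_def)
  have "card (edges (power_of_graph H k)) = m"
    unfolding E[symmetric] using f cE by (simp add: card_image inj_on_edge_image[OF U] bij_betw_def)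
  then have cEH: "card (edges H) = m" by (simp add: card_edges_power)
  have conP: "connected_hypergraph (power_of_graph H k)" by (rule connected_iso[OF iso U U' con])
  then have conH: "connected_hypergraph H" using connected_power_iff[OF H k2] by simp
  \<comment> \<open>An edge provides a vertex, so there is exactly one component; an empty vertex
    set would have none.\<close>
  have "edges G \<noteq> {}" using cE m by auto
  then obtain e where "e \<in> edges G" by blast
  then have "e \<subseteq> verts G" "card e = k" using U by (auto simp: uniform_hypergraph_def)
  then have "verts G \<noteq> {}" using k by auto
  then have "int m * (int k - 1) - int (card (verts G)) + 1 = 2"
    using cyclomatic_connected[OF con, of k] cyc cE by simp
  moreover have "card (verts G) = card (verts H) + m * (k - 2)"
    using bij_betw_same_card[OF f] card_verts_power[OF H, of k] cEH by simp
  moreover obtain n where "k = 2 + n" using k2 le_Suc_ex by blast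
  ultimately have "card (verts H) = m - 1"
    by (simp add: algebra_simps)
  then show ?thesis using that H iso conH cEH by blast
qed

section \<open>Comparison of spectral radii\<close>

lemma spectral_radius_power_le:
  assumes H: "simple_graph H" and k: "k \<ge> 3" and ne: "verts H \<noteq> {}" and mu: "0 \<le> mu"
    and bnd: "\<And>y. (\<forall>v. 0 \<le> y v) \<Longrightarrow>
        2 * (\<Sum>e\<in>edges H. prod y e) \<le> mu * (\<Sum>v\<in>verts H. (y v)\<^sup>2)"
  shows "spectral_radius k (power_of_graph H k) \<le> (root k mu)\<^sup>2"
proof -
  let ?P = "power_of_graph H k"
  have U: "uniform_hypergraph k ?P" using uniform_power[OF H] k by simp
  obtain v where "v \<in> verts H" using ne by blast
  then have "eigenvalue k ?P 0" by (intro eigenvalue_zero[OF U k, of "Inl v"]) (simp add: verts_power)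
  then show ?thesis unfolding spectral_radius_def
    by (intro cSup_least) (auto intro: eigenvalue_power_bound[OF H k mu _ bnd])
qed

text \<open>The graph \<open>H_graph m\<close> is itself connected with \<open>m - 1\<close>
  vertices and \<open>m\<close> edges, so \<open>bicyclic_form\<close> gives the upper bound. The
  vector \<open>perron\<close> attains it.\<close>

lemma (in extremal_weights) spectral_radius_B_P:
  assumes k: "k \<ge> 3"
  shows "spectral_radius k (B_P k m) = (root k rho)\<^sup>2"
proof (rule antisym)
  note H = simple_H_graph[OF m]
  have cV: "card (verts (H_graph m)) = m - 1" and ne: "verts (H_graph m) \<noteq> {}"
    using m by (auto simp: verts_H_graph)
  have rho0: "0 < rho" using rho by simp
  have bnd: "2 * (\<Sum>e\<in>edges (H_graph m). prod y e) \<le> rho * (\<Sum>v\<in>verts (H_graph m). (y v)\<^sup>2)"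
    if "\<forall>v. 0 \<le> y v" for y
    using that by (intro bicyclic_form(1)[OF H connected_H_graph[OF m] cV card_edges_H_graph[OF m]]) simp
  show "spectral_radius k (B_P k m) \<le> (root k rho)\<^sup>2"
    unfolding B_P_def using rho0 by (intro spectral_radius_power_le[OF H k ne _ bnd]) auto
  have "0 < perron v" for v using pos by (simp add: perron_def)
  then have "eigenvalue k (B_P k m) (complex_of_real ((root k rho)\<^sup>2))"
    unfolding B_P_def
    by (rule eigenvalue_power_of_eigenvector[OF H k rho0 ne _ perron_eigenvector])
  then have "(root k rho)\<^sup>2 \<in> {cmod lam | lam. eigenvalue k (B_P k m) lam}"
    by (force simp: norm_power)
  moreover have "bdd_above {cmod lam | lam. eigenvalue k (B_P k m) lam}"
    unfolding B_P_def using rho0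
    by (intro bdd_aboveI[of _ "(root k rho)\<^sup>2"]) (auto intro: eigenvalue_power_bound[OF H k _ _ bnd])
  ultimately show "(root k rho)\<^sup>2 \<le> spectral_radius k (B_P k m)"
    unfolding spectral_radius_def by (rule cSup_upper)
qed

text \<open>Equality at a nonzero nonnegative vector would make \<open>H\<close> isomorphic to
  \<open>H_graph m\<close>. The form inequality is therefore strict, and the gap
  \<open>mu < rho\<close> passes to the spectral radii.\<close>

lemma (in extremal_weights) spectral_radius_less:
  assumes H: "simple_graph H" and con: "connected_hypergraph H" and cV: "card (verts H) = m - 1"
    and cE: "card (edges H) = m" and noniso: "\<not> hypergraph_iso H (H_graph m)" and k: "k \<ge> 3"
  shows "spectral_radius k (power_of_graph H k) < spectral_radius k (B_P k m)"
proof -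
  have ne: "verts H \<noteq> {}" using cV m by auto
  have strict: "2 * (\<Sum>e\<in>edges H. prod y e) < rho * (\<Sum>v\<in>verts H. (y v)\<^sup>2)"
    if y: "\<And>v. 0 \<le> y v" "\<exists>v\<in>verts H. y v \<noteq> 0" for y
  proof (rule le_neq_trans)
    show "2 * (\<Sum>e\<in>edges H. prod y e) \<le> rho * (\<Sum>v\<in>verts H. (y v)\<^sup>2)"
      by (rule bicyclic_form(1)[OF H con cV cE y(1)])
    show "2 * (\<Sum>e\<in>edges H. prod y e) \<noteq> rho * (\<Sum>v\<in>verts H. (y v)\<^sup>2)"
    proof
      assume "2 * (\<Sum>e\<in>edges H. prod y e) = rho * (\<Sum>v\<in>verts H. (y v)\<^sup>2)"
      from bicyclic_form(2)[OF H con cV cE y(1) this y(2)] have "hypergraph_iso H (H_graph m)"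
        by (elim exE conjE) (rule iso_H_graph[OF H m cV])
      then show False using noniso by contradiction
    qed
  qed
  obtain mu where mu: "0 \<le> mu" "mu < rho"
    and bnd: "\<And>y. (\<forall>v. 0 \<le> y v) \<Longrightarrow> 2 * (\<Sum>e\<in>edges H. prod y e) \<le> mu * (\<Sum>v\<in>verts H. (y v)\<^sup>2)"
  proof (rule edge_form_strict_gap[OF H ne])
    show "2 * (\<Sum>e\<in>edges H. prod y e) < rho * (\<Sum>v\<in>verts H. (y v)\<^sup>2)"
      if "\<And>v. 0 \<le> y v" "\<exists>v\<in>verts H. y v \<noteq> 0" for y
      using that by (rule strict)
  qed (rule that)
  have "spectral_radius k (power_of_graph H k) \<le> (root k mu)\<^sup>2"
    by (rule spectral_radius_power_le[OF H k ne mu(1) bnd])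
  also have "\<dots> < (root k rho)\<^sup>2"
    using mu k by (intro power_strict_mono) auto
  finally show ?thesis by (simp add: spectral_radius_B_P[OF k])
qed

theorem theorem3p8:
  fixes k m :: nat
  assumes "k \<ge> 3" and "m > 5"
  shows "bicyclic_power_hypergraph k m (B_P k m) \<and>
    (\<forall>G :: 'a hypergraph. bicyclic_power_hypergraph k m G \<longrightarrow>
       spectral_radius k G \<le> spectral_radius k (B_P k m) \<and>
       (spectral_radius k G = spectral_radius k (B_P k m) \<longleftrightarrow> hypergraph_iso G (B_P k m)))"
proof (intro conjI allI impI)
  show B: "bicyclic_power_hypergraph k m (B_P k m)"
    using assms by (rule bicyclic_power_hypergraph_B_P)
  fix G :: "'a hypergraph" assume G: "bicyclic_power_hypergraph k m G"
  have U: "uniform_hypergraph k G" and UB: "uniform_hypergraph k (B_P k m)" and k1: "k \<ge> 1" "k \<ge> 2"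
    using G B assms by (auto simp: bicyclic_power_hypergraph_def)
  obtain H :: "'a hypergraph" where H: "simple_graph H" and iso: "hypergraph_iso G (power_of_graph H k)"
    and con: "connected_hypergraph H" and cV: "card (verts H) = m - 1" and cE: "card (edges H) = m"
    using bicyclic_power_hypergraphE[OF G assms] by blast
  obtain rho B C D where "extremal_weights m rho B C D" using extremal_weights_exist[OF assms(2)] .
  then interpret extremal_weights m rho B C D .
  have eq: "spectral_radius k G = spectral_radius k (power_of_graph H k)"
    by (rule spectral_radius_iso[OF iso U uniform_power[OF H k1(2)] k1(1)])
  \<comment> \<open>Either the base graph is extremal and its isomorphism lifts to the powers, or
    the radius is strictly smaller. Both the maximum and its uniqueness follow from this alternative
    and isomorphism invariance.\<close>
  have "hypergraph_iso G (B_P k m) \<or> spectral_radius k G < spectral_radius k (B_P k m)"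
  proof (cases "hypergraph_iso H (H_graph m)")
    case True
    then show ?thesis unfolding B_P_def
      using hypergraph_iso_trans[OF iso iso_power[OF H]] by blast
  next
    case False
    then show ?thesis using spectral_radius_less[OF H con cV cE _ assms(1)] eq by simp
  qed
  moreover have "spectral_radius k G = spectral_radius k (B_P k m)" if "hypergraph_iso G (B_P k m)"
    by (rule spectral_radius_iso[OF that U UB k1(1)])
  ultimately show "spectral_radius k G \<le> spectral_radius k (B_P k m)"
    and "spectral_radius k G = spectral_radius k (B_P k m) \<longleftrightarrow> hypergraph_iso G (B_P k m)"
    by auto
qed

end
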